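(* Let $\sigma(u)$, $0\le u<\infty$, be a distribution function, and suppose that $\sigma$ possesses finite moments of all orders $n\in\mathbb{Z}$. Let $$\mu_n=\int_{0}^{\infty}u^n\,d\sigma(u),\qquad n\in\mathbb{Z}.$$ If $$\int_{0}^{\infty}\frac{\log\sigma'(u^2)}{1+u^2}\,du>-\infty,$$ where $\sigma'(u)$ is the derivative of the absolutely continuous part of $\sigma(u)$ (and $\sigma'(u^2)$ is its value at $u^2$), then the strong Stieltjes moment problem with moment sequence $\{\mu_n\}_{n\in\mathbb{Z}}$ is indeterminate.
   Context: A distribution function on an interval $I\subset\mathbb{R}$ is a real-valued, bounded, non-decreasing function on $I$ having infinitely many points of increase in $I$. Two distribution functions $\alpha_1,\alpha_2$ on $I$ are regarded as equal if $\int_I f\,d\alpha_1=\int_I f\,d\alpha_2$ for all continuous functions $f$ with compact support. The moment of order $n\in\mathbb{Z}$ of $\sigma$ on $I$ is $\int_I u^n\,d\sigma(u)$; "finite moments of all orders" means that these are finite for all $n\in\mathbb{Z}$ (positive, zero and negative); in particular $\sigma$ has no mass at the origin. The strong Stieltjes moment problem for a real sequence $\{\mu_n\}_{n\in\mathbb{Z}}$ is: find a distribution function $\alpha$ on $[0,\infty[$ such that $\mu_n=\int_{0}^{\infty}x^n\,d\alpha(x)$ for all $n\in\mathbb{Z}$. It is determinate if it has at most one solution $\alpha$ (up to the equality above), and indeterminate otherwise. *)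

theory Defs
  imports "HOL-Analysis.Analysis"
begin

section \<open>Distribution functions and their Stieltjes measures\<close>

definition point_of_increase :: "real set \<Rightarrow> (real \<Rightarrow> real) \<Rightarrow> real \<Rightarrow> bool" where
  "point_of_increase I F x \<longleftrightarrow>
     x \<in> I \<and> (\<forall>\<epsilon>>0. \<exists>y\<in>I \<inter> ball x \<epsilon>. \<exists>z\<in>I \<inter> ball x \<epsilon>. F y < F z)"

definition distribution_function :: "real set \<Rightarrow> (real \<Rightarrow> real) \<Rightarrow> bool" where
  "distribution_function I F \<longleftrightarrow>
     bounded (F ` I) \<and> mono_on I F \<and> infinite {x. point_of_increase I F x}"

text \<open>
  A distribution function on the half-line need not be right-continuous, whereas
  \<^const>\<open>interval_measure\<close> expects a right-continuous function on the whole line. We therefore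
  pass to right limits on the half-line and extend by the constant \<open>F 0\<close> to the left, so that
  \<open>{0}\<close> gets the mass \<open>F(0+) - F(0)\<close>. Values of \<open>F\<close> at negative arguments are irrelevant.
\<close>

definition right_limit_extension :: "(real \<Rightarrow> real) \<Rightarrow> real \<Rightarrow> real" where
  "right_limit_extension F x = (if x < 0 then F 0 else Lim (at_right x) F)"

definition stieltjes_measure :: "(real \<Rightarrow> real) \<Rightarrow> real measure" where
  "stieltjes_measure F = interval_measure (right_limit_extension F)"

lemma sets_stieltjes_measure [simp, measurable_cong]:
  "sets (stieltjes_measure F) = sets borel"
  by (simp add: stieltjes_measure_def)

lemma space_stieltjes_measure [simp]: "space (stieltjes_measure F) = UNIV"
  by (simp add: stieltjes_measure_def)

definition distribution_eq :: "(real \<Rightarrow> real) \<Rightarrow> (real \<Rightarrow> real) \<Rightarrow> bool" where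
  "distribution_eq \<alpha> \<beta> \<longleftrightarrow>
     (\<forall>f :: real \<Rightarrow> real. continuous_on {0..} f \<longrightarrow> compact (closure {x\<in>{0..}. f x \<noteq> 0}) \<longrightarrow>
        (LINT x:{0..}|stieltjes_measure \<alpha>. f x) = (LINT x:{0..}|stieltjes_measure \<beta>. f x))"


section \<open>The strong Stieltjes moment problem\<close>

text \<open>
  Powers are taken in \<^typ>\<open>ennreal\<close>, where \<open>inverse 0 = \<infinity>\<close>: a mass at the origin makes all
  moments of negative order infinite. (In \<^typ>\<open>real\<close>, \<open>0 powi n\<close> would be \<open>0\<close> for \<open>n < 0\<close>.)
\<close>

definition ext_moment :: "(real \<Rightarrow> real) \<Rightarrow> int \<Rightarrow> ennreal" where
  "ext_moment \<alpha> n = (\<integral>\<^sup>+x\<in>{0..}. (ennreal x powi n) \<partial>stieltjes_measure \<alpha>)"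

definition moment :: "(real \<Rightarrow> real) \<Rightarrow> int \<Rightarrow> real" where
  "moment \<alpha> n = enn2real (ext_moment \<alpha> n)"

definition finite_moments :: "(real \<Rightarrow> real) \<Rightarrow> bool" where
  "finite_moments \<alpha> \<longleftrightarrow> (\<forall>n. ext_moment \<alpha> n < \<infinity>)"

definition strong_stieltjes_solution :: "(int \<Rightarrow> real) \<Rightarrow> (real \<Rightarrow> real) \<Rightarrow> bool" where
  "strong_stieltjes_solution \<mu> \<alpha> \<longleftrightarrow>
     distribution_function {0..} \<alpha> \<and> finite_moments \<alpha> \<and> (\<forall>n. \<mu> n = moment \<alpha> n)"

definition determinate :: "(int \<Rightarrow> real) \<Rightarrow> bool" where
  "determinate \<mu> \<longleftrightarrow>
     (\<forall>\<alpha> \<beta>. strong_stieltjes_solution \<mu> \<alpha> \<longrightarrow> strong_stieltjes_solution \<mu> \<beta> \<longrightarrow>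
        distribution_eq \<alpha> \<beta>)"

abbreviation indeterminate :: "(int \<Rightarrow> real) \<Rightarrow> bool" where
  "indeterminate \<mu> \<equiv> \<not> determinate \<mu>"


section \<open>The derivative of the absolutely continuous part\<close>

text \<open>\<open>A\<close> is the absolutely continuous part in the Lebesgue decomposition of \<open>M\<close>.\<close>

definition is_ac_part :: "real measure \<Rightarrow> real measure \<Rightarrow> bool" where
  "is_ac_part M A \<longleftrightarrow>
     sets A = sets borel \<and> absolutely_continuous lborel A \<and>
     (\<exists>S. sets S = sets borel \<and> (\<exists>N\<in>null_sets lborel. emeasure S (- N) = 0) \<and>
          (\<forall>B\<in>sets borel. emeasure M B = emeasure A B + emeasure S B))"

definition ac_part :: "real measure \<Rightarrow> real measure" where
  "ac_part M = (THE A. is_ac_part M A)"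

definition ac_derivative :: "(real \<Rightarrow> real) \<Rightarrow> real \<Rightarrow> ennreal" where
  "ac_derivative F = RN_deriv lborel (ac_part (stieltjes_measure F))"


section \<open>The logarithmic integral\<close>

text \<open>The real function \<^const>\<open>ln\<close> has \<open>ln 0 = 0\<close>; here the logarithm of \<open>0\<close> is \<open>-\<infinity>\<close>.\<close>

definition ext_ln :: "ennreal \<Rightarrow> ereal" where
  "ext_ln x = (if x = 0 then -\<infinity> else if x = \<infinity> then \<infinity> else ereal (ln (enn2real x)))"

text \<open>
  Integral of the positive part minus integral of the negative part. In \<^typ>\<open>ereal\<close>,
  \<open>\<infinity> - \<infinity> = \<infinity>\<close>; this case does not arise for the logarithmic integral below, whose positive part
  is always finite, because \<open>u \<sigma>'(u\<^sup>2)\<close> is integrable on the half-line.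
\<close>

definition ext_integral :: "'a measure \<Rightarrow> ('a \<Rightarrow> ereal) \<Rightarrow> ereal" where
  "ext_integral M f =
     enn2ereal (\<integral>\<^sup>+x. e2ennreal (f x) \<partial>M) - enn2ereal (\<integral>\<^sup>+x. e2ennreal (- f x) \<partial>M)"

definition log_integral :: "(real \<Rightarrow> real) \<Rightarrow> ereal" where
  "log_integral \<sigma> =
     ext_integral (restrict_space lborel {0..})
       (\<lambda>u. ext_ln (ac_derivative \<sigma> (u\<^sup>2)) / ereal (1 + u\<^sup>2))"

section \<open>Well-definedness\<close>

lemma right_limit_extension_eq:
  assumes "distribution_function {0..} F" "x \<ge> 0"
  shows "right_limit_extension F x = (INF y\<in>{x<..}. F y)"
    and "(F \<longlongrightarrow> right_limit_extension F x) (at_right x)"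
proof -
  have m: "mono_on {0..} F" and b: "bounded (F ` {0..})"
    using assms(1) by (auto simp: distribution_function_def)
  have bb: "bdd_below (F ` {x<..})"
    by (rule bdd_below_mono[OF bounded_imp_bdd_below[OF b]]) (use assms(2) in auto)
  let ?L = "INF y\<in>{x<..}. F y"
  have lim: "(F \<longlongrightarrow> ?L) (at_right x)"
  proof (rule order_tendstoI)
    fix a assume "a < ?L"
    then have "a < F y" if "y > x" for y
      using that cINF_lower[OF bb, of y] by simp
    then show "eventually (\<lambda>y. a < F y) (at_right x)"
      by (auto simp: eventually_at_filter)
  next
    fix a assume "?L < a"
    then obtain z where z: "z > x" "F z < a"
      using cINF_less_iff[OF _ bb] by auto
    have "F y < a" if "x < y" "y < z" for y
      using mono_onD[OF m, of y z] that z assms(2) by auto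
    then show "eventually (\<lambda>y. F y < a) (at_right x)"
      using z(1) by (auto simp: eventually_at_right_field)
  qed
  then show "right_limit_extension F x = ?L"
    using assms(2) by (auto simp: right_limit_extension_def intro: tendsto_Lim)
  with lim show "(F \<longlongrightarrow> right_limit_extension F x) (at_right x)" by simp
qed

lemma right_limit_extension_bounds:
  assumes "distribution_function {0..} F" "x \<ge> 0"
  shows "F x \<le> right_limit_extension F x" "\<And>y. x < y \<Longrightarrow> right_limit_extension F x \<le> F y"
proof -
  have m: "mono_on {0..} F" and b: "bounded (F ` {0..})"
    using assms(1) by (auto simp: distribution_function_def)
  have bb: "bdd_below (F ` {x<..})"
    by (rule bdd_below_mono[OF bounded_imp_bdd_below[OF b]]) (use assms(2) in auto)
  show "F x \<le> right_limit_extension F x"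
    unfolding right_limit_extension_eq(1)[OF assms]
    by (rule cINF_greatest) (use assms(2) in \<open>auto intro: mono_onD[OF m]\<close>)
  show "right_limit_extension F x \<le> F y" if "x < y" for y
    unfolding right_limit_extension_eq(1)[OF assms]
    by (rule cINF_lower[OF bb]) (use that in auto)
qed

lemma mono_right_limit_extension:
  assumes F: "distribution_function {0..} F" and "x \<le> y"
  shows "right_limit_extension F x \<le> right_limit_extension F y"
proof -
  have *: "F 0 \<le> right_limit_extension F z" if "z \<ge> 0" for z
    using order.trans[OF mono_onD[of "{0..}" F 0 z] right_limit_extension_bounds(1)[OF F, of z]]
      F that by (auto simp: distribution_function_def)
  show ?thesis
  proof (cases "x = y \<or> x < 0")
    case True
    then show ?thesis
      using *[of y] by (cases "y < 0") (auto simp: right_limit_extension_def)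
  next
    case False
    then have "x \<ge> 0" "x < y" "y \<ge> 0" using \<open>x \<le> y\<close> by auto
    then show ?thesis
      using right_limit_extension_bounds(2)[OF F, of x y] right_limit_extension_bounds(1)[OF F, of y]
      by linarith
  qed
qed

lemma right_cont_right_limit_extension:
  assumes F: "distribution_function {0..} F"
  shows "continuous (at_right x) (right_limit_extension F)"
proof (cases "x < 0")
  case True
  then have "eventually (\<lambda>y. right_limit_extension F y = F 0) (at_right x)"
    by (auto simp: eventually_at_right_field right_limit_extension_def intro!: exI[of _ 0])
  with True show ?thesis
    by (auto simp: continuous_within right_limit_extension_def[of _ x] tendsto_eventually)
next
  case False
  then have x: "x \<ge> 0" by simp
  show ?thesis unfolding continuous_within
  proof (rule order_tendstoI)
    fix a assume "a < right_limit_extension F x"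
    then show "eventually (\<lambda>y. a < right_limit_extension F y) (at_right x)"
      using mono_right_limit_extension[OF F, of x]
      by (auto simp: eventually_at_right_field intro!: exI[of _ "x + 1"] intro: less_le_trans)
  next
    fix a assume "right_limit_extension F x < a"
    from order_tendstoD(2)[OF right_limit_extension_eq(2)[OF F x] this]
    obtain z where z: "z > x" "\<And>y. x < y \<Longrightarrow> y < z \<Longrightarrow> F y < a"
      by (auto simp: eventually_at_right_field)
    have "right_limit_extension F y < a" if "x < y" "y < z" for y
      using right_limit_extension_bounds(2)[OF F, of y "(y + z) / 2"] z(2)[of "(y + z) / 2"] that x
      by auto
    then show "eventually (\<lambda>y. right_limit_extension F y < a) (at_right x)"
      using z(1) by (auto simp: eventually_at_right_field)
  qed
qed

lemma finite_measure_stieltjes_measure: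
  assumes F: "distribution_function {0..} F"
  shows "finite_measure (stieltjes_measure F)"
proof -
  obtain K where K: "\<And>x. x \<ge> 0 \<Longrightarrow> \<bar>F x\<bar> \<le> K"
    using F by (auto simp: distribution_function_def bounded_iff)
  have K': "\<bar>right_limit_extension F x\<bar> \<le> K" for x
    using right_limit_extension_bounds(1)[OF F, of x] right_limit_extension_bounds(2)[OF F, of x "x+1"]
      K[of 0] K[of x] K[of "x+1"]
    by (cases "x < 0") (auto simp: right_limit_extension_def[of _ x])
  let ?A = "\<lambda>n::nat. {- real n<..real n}"
  have U: "(\<Union>n. ?A n) = UNIV"
  proof -
    have "\<exists>n. - real n < x \<and> x \<le> real n" for x
    proof -
      obtain n where "\<bar>x\<bar> < real n" using reals_Archimedean2 by blast
      then have "- real n < x \<and> x \<le> real n" by linarith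
      then show ?thesis ..
    qed
    then show ?thesis by auto
  qed
  have "emeasure (stieltjes_measure F) UNIV = (SUP n. emeasure (stieltjes_measure F) (?A n))"
    unfolding U[symmetric] by (rule SUP_emeasure_incseq[symmetric]) (auto simp: incseq_def)
  also have "\<dots> \<le> ennreal (2 * K)"
  proof (rule SUP_least)
    fix n
    show "emeasure (stieltjes_measure F) (?A n) \<le> ennreal (2 * K)"
      unfolding stieltjes_measure_def
      by (subst emeasure_interval_measure_Ioc)
         (use K'[of "real n"] K'[of "- real n"] in
           \<open>auto intro!: mono_right_limit_extension[OF F] right_cont_right_limit_extension[OF F] ennreal_leI\<close>)
  qed
  finally show ?thesis
    by (intro finite_measureI) (auto simp: top_unique)
qed

lemma is_ac_part_unique:
  assumes "is_ac_part M A" "is_ac_part M B"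
  shows "A = B"
proof (rule measure_eqI)
  from assms show "sets A = sets B" by (simp add: is_ac_part_def)
  from assms(1) obtain S N where 1: "sets A = sets borel" "absolutely_continuous lborel A"
    "sets S = sets borel" "N \<in> null_sets lborel" "emeasure S (- N) = 0"
    "\<And>B. B \<in> sets borel \<Longrightarrow> emeasure M B = emeasure A B + emeasure S B"
    by (auto simp: is_ac_part_def)
  from assms(2) obtain T N' where 2: "sets B = sets borel" "absolutely_continuous lborel B"
    "sets T = sets borel" "N' \<in> null_sets lborel" "emeasure T (- N') = 0"
    "\<And>C. C \<in> sets borel \<Longrightarrow> emeasure M C = emeasure B C + emeasure T C"
    by (auto simp: is_ac_part_def)
  fix X assume "X \<in> sets A"
  then have X: "X \<in> sets borel" using 1 by simp
  have N: "N \<union> N' \<in> null_sets lborel" "N \<in> sets borel" "N' \<in> sets borel" using 1 2 by auto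
  let ?Y = "X - (N \<union> N')"
  have "N \<union> N' \<in> null_sets A" "N \<union> N' \<in> null_sets B"
    using 1(2) 2(2) N(1) by (auto simp: absolutely_continuous_def)
  then have "emeasure A ?Y = emeasure A X" "emeasure B ?Y = emeasure B X"
    using X 1 2 by (auto intro: emeasure_Diff_null_set)
  moreover have "emeasure S ?Y = 0"
    by (rule emeasure_eq_0[of "- N"]) (use 1(3,5) N in auto)
  moreover have "emeasure T ?Y = 0"
    by (rule emeasure_eq_0[of "- N'"]) (use 2(3,5) N in auto)
  ultimately show "emeasure A X = emeasure B X"
    using 1(6)[of ?Y] 2(6)[of ?Y] N X by simp
qed

lemma is_ac_part_exists:
  assumes "finite_measure M" and M: "sets M = sets borel"
  shows "\<exists>A. is_ac_part M A"
proof -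
  interpret finite_measure M by fact
  let ?s = "SUP N\<in>null_sets lborel. emeasure M N"
  have "null_sets lborel \<noteq> ({} :: real set set)" by auto
  from ennreal_SUP_countable_SUP[OF this, of "emeasure M"] obtain f :: "nat \<Rightarrow> ennreal" where
    f: "range f \<subseteq> emeasure M ` null_sets lborel" "?s = (SUP n. f n)" by auto
  from f(1) have "\<forall>n. \<exists>N\<in>null_sets lborel. f n = emeasure M N" by auto
  then obtain K where K: "\<And>n. K n \<in> null_sets lborel" "\<And>n. f n = emeasure M (K n)"
    by metis
  define N where "N = (\<Union>n. K n)"
  have N: "N \<in> null_sets lborel" unfolding N_def by (rule null_sets_UN) (rule K(1))
  then have NM: "N \<in> sets M" using null_setsD2[OF N] unfolding M by simp
  have s: "?s \<le> emeasure M N"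
    unfolding f(2) K(2) by (intro SUP_least emeasure_mono) (auto simp: N_def[symmetric] NM, auto simp: N_def)
  define A where "A = density M (indicator (- N))"
  define S where "S = density M (indicator N)"
  have N': "N \<in> sets borel" "- N \<in> sets M" "- N \<in> sets borel" using NM unfolding M by auto
  have A: "emeasure A B = emeasure M (B - N)" if "B \<in> sets borel" for B
    using that N'(2) unfolding A_def Diff_eq
    by (subst emeasure_restricted) (simp_all only: M Int_commute)
  have S: "emeasure S B = emeasure M (B \<inter> N)" if "B \<in> sets borel" for B
    using that NM unfolding S_def
    by (subst emeasure_restricted) (simp_all only: M Int_commute)
  have "absolutely_continuous lborel A" unfolding absolutely_continuous_def
  proof
    fix Z :: "real set" assume Z: "Z \<in> null_sets lborel"
    then have ZM: "Z \<in> sets M" "Z \<in> sets borel" unfolding M by (auto dest: null_setsD2)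
    have "emeasure M (Z \<union> N) \<le> ?s" by (rule SUP_upper) (rule null_sets.Un[OF Z N])
    with s have "emeasure M (Z \<union> N) \<le> emeasure M N" by simp
    moreover have "emeasure M (Z \<union> N) = emeasure M N + emeasure M (Z - N)"
      using ZM NM by (subst plus_emeasure) (auto intro!: arg_cong[of _ _ "emeasure M"])
    ultimately have "emeasure M (Z - N) = 0"
      using emeasure_finite[of N] by (cases "emeasure M N"; cases "emeasure M (Z - N)")
        (auto simp flip: ennreal_plus simp: top_unique)
    then have "emeasure A Z = 0" using A[OF ZM(2)] by simp
    moreover have "Z \<in> sets A" unfolding A_def sets_density by (rule ZM(1))
    ultimately show "Z \<in> null_sets A" by (rule null_setsI)
  qed
  moreover have "emeasure S (- N) = 0" using S[OF N'(3)] by simp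
  moreover have "emeasure M B = emeasure A B + emeasure S B" if "B \<in> sets borel" for B
  proof -
    have "B - N \<in> sets M" "B \<inter> N \<in> sets M" using that N'(1) unfolding M by auto
    then have "emeasure M (B - N) + emeasure M (B \<inter> N) = emeasure M ((B - N) \<union> (B \<inter> N))"
      by (rule plus_emeasure) auto
    then show ?thesis using A[OF that] S[OF that] by (simp add: Un_Diff_Int)
  qed
  moreover have "sets A = sets borel" "sets S = sets borel"
    unfolding A_def S_def sets_density by (rule M)+
  ultimately have "is_ac_part M A" unfolding is_ac_part_def
    using N by blast
  then show ?thesis ..
qed

lemma is_ac_part_ac_part:
  assumes "distribution_function {0..} F"
  shows "is_ac_part (stieltjes_measure F) (ac_part (stieltjes_measure F))"
  unfolding ac_part_def
  using is_ac_part_exists[OF finite_measure_stieltjes_measure[OF assms]] is_ac_part_unique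
  by (metis sets_stieltjes_measure theI)

end

theory Submission
  imports Defs "HOL-Probability.Distribution_Functions"
    "HOL-Computational_Algebra.Fundamental_Theorem_Algebra"
begin

text \<open>
  Let \<open>M\<close> be the measure of \<open>\<sigma>\<close> and let \<open>V\<close> be the space of Laurent polynomials. It suffices to find
  a bounded function \<open>\<phi>\<close>, \<open>\<bar>\<phi>\<bar> \<le> 1\<close>, that is not \<open>M\<close>-almost everywhere zero but satisfies
  \<open>\<integral> \<phi> r dM = 0\<close> for all \<open>r \<in> V\<close>: then \<open>(1 + \<phi>/2) dM\<close> is a different positive measure with
  the same moments.

  Such a \<open>\<phi>\<close> exists as soon as \<open>f(u) = 1/(1+u)\<close> cannot be approximated by Laurent polynomials, in
  the quantitative form \<open>c \<le> \<integral> min(1,\<bar>f-r\<bar>) dM * \<integral> max(1,\<bar>f-r\<bar>) dM\<close> with \<open>c > 0\<close>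
  independent of \<open>r\<close>. One minimises \<open>J(r) = \<integral> h(f-r) dM\<close> over \<open>V\<close>, where \<open>h\<close> is the Huber
  function (quadratic near \<open>0\<close>, linear with slope \<open>\<plusminus>1\<close> far away). A minimiser need not exist, but
  the derivatives \<open>h'(f-r\<^sub>k)\<close> along a minimising sequence form a Cauchy sequence in \<open>L\<^sup>2\<close>, and
  their limit \<open>\<phi>\<close> is bounded by \<open>1\<close>, annihilates \<open>V\<close> by the Euler equation, and is
  nonzero by the lower bound, as \<open>\<bar>h'(x)\<bar> = min(1,\<bar>x\<bar>)\<close>
  (\<open>exists_bounded_annihilator\<close>). This replaces the Hahn-Banach theorem and the duality of
  \<open>L\<^sup>1\<close> and \<open>L\<^sup>\<infinity>\<close>.

  The lower bound is where the logarithmic integral enters. Writing \<open>r(u) = p(u)/u\<^sup>N\<close>, the function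
  \<open>(1+u) (f(u) - r(u))\<close> is a Laurent polynomial with the value \<open>1\<close> at \<open>u = -1\<close>. Put \<open>u = t\<^sup>2\<close>. By the
  Jensen-type inequality \<open>ln \<bar>Q(-1)\<bar> \<le> E ln \<bar>Q(t\<^sup>2)\<bar>\<close> for polynomials \<open>Q\<close>
  (subharmonicity of \<open>ln \<bar>Q(z\<^sup>2)\<bar>\<close> in the upper half-plane, evaluated at \<open>z = \<i>\<close>; here \<open>E\<close> is the mean
  with respect to the half-Cauchy distribution \<open>(2/\<pi>) dt/(1+t\<^sup>2)\<close>, \<open>t > 0\<close>, lemma
  \<open>half_cauchy_ln_cmod_poly\<close>), the mean of \<open>ln \<bar>f-r\<bar>\<close> is bounded below uniformly in \<open>r\<close>. Splitting
  \<open>\<bar>x\<bar> = min(1,\<bar>x\<bar>) max(1,\<bar>x\<bar>)\<close> and applying the concavity of the logarithm to each factor times the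
  density of \<open>M\<close>, whose logarithm has a finite mean by hypothesis, gives the claim
  (\<open>log_integrable_density_separates\<close>).
\<close>

section \<open>The logarithmic sine integral\<close>

definition ln_sin :: "real \<Rightarrow> real" where "ln_sin x = ln \<bar>sin x\<bar>"

lemma sin_ge_linear:
  fixes x :: real assumes "0 \<le> x" "x \<le> pi / 2" shows "2 / pi * x \<le> sin x"
proof -
  have "concave_on {0..pi} sin"
  proof (rule f''_le0_imp_concave)
    show "(sin has_real_derivative cos x) (at x)" for x :: real by (rule DERIV_sin)
    show "(cos has_real_derivative - sin x) (at x)" for x :: real by (rule DERIV_cos)
  qed (auto simp: sin_ge_zero)
  moreover have "2 / pi * x \<in> {0..1}" using assms by (simp add: field_simps)
  ultimately have "(1 - 2 / pi * x) * sin 0 + 2 / pi * x * sin (pi / 2)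
      \<le> sin ((1 - 2 / pi * x) *\<^sub>R 0 + (2 / pi * x) *\<^sub>R (pi / 2))"
    by (intro concave_onD) auto
  then show ?thesis by simp
qed

text \<open>
  The singularity at \<open>0\<close> is dominated by \<open>x powr (-1/2)\<close>, since \<open>sin x \<ge> 2x/\<pi>\<close> and
  \<open>- ln y \<le> 2 y powr (-1/2)\<close>.
\<close>

lemma integrable_ln_sin_quarter: "ln_sin absolutely_integrable_on {0..pi/2}"
proof (rule measurable_bounded_by_integrable_imp_absolutely_integrable)
  have "ln_sin \<in> borel_measurable borel" unfolding ln_sin_def by measurable
  then show "ln_sin \<in> borel_measurable (lebesgue_on {0..pi/2})"
    by (intro measurable_restrict_space1 measurable_completion) simp
  have "(\<lambda>x::real. x powr (-1/2)) integrable_on {0..pi/2}"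
    by (rule integrable_on_powr_from_0) auto
  then show "(\<lambda>x. 2 * (2 / pi) powr (-1/2) * x powr (-1/2)) integrable_on {0..pi/2}"
    by (rule integrable_on_mult_right)
  fix x assume x: "x \<in> {0..pi/2}"
  show "norm (ln_sin x) \<le> 2 * (2 / pi) powr (-1/2) * x powr (-1/2)"
  proof (cases "x = 0")
    case False
    then have x': "0 < x" "x \<le> pi / 2" "x < pi" using x by auto
    then have s: "0 < sin x" "2 / pi * x \<le> sin x" "0 < 2 / pi * x"
      using sin_ge_linear[of x] sin_gt_zero[of x] by simp_all
    have "- ln (sin x) = 2 * ln (sin x powr (-1/2))"
      using s by (simp add: ln_powr)
    also have "\<dots> \<le> 2 * (sin x powr (-1/2))"
      using s ln_bound[of "sin x powr (-1/2)"] by simp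
    also have "\<dots> \<le> 2 * (2 / pi * x) powr (-1/2)"
      using s by (intro mult_left_mono powr_mono2') auto
    also have "\<dots> = 2 * (2 / pi) powr (-1/2) * x powr (-1/2)"
      using x' by (subst powr_mult) auto
    finally have "- ln (sin x) \<le> 2 * (2 / pi) powr (-1/2) * x powr (-1/2)" .
    then show ?thesis using s(1) by (simp add: ln_sin_def)
  qed (auto simp: ln_sin_def)
qed auto

lemma ln_sin_nonpos: "ln_sin x \<le> 0"
  by (cases "sin x = 0") (auto simp: ln_sin_def)

lemma ln_cos_nonpos: "ln \<bar>cos x\<bar> \<le> 0" for x :: real
  by (cases "cos x = 0") auto

lemma ln_sin_minus: "ln_sin (- x) = ln_sin x"
  by (simp add: ln_sin_def)

lemma ln_sin_diff_pi: "ln_sin (x + - pi) = ln_sin x"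
  by (simp add: ln_sin_def)

text \<open>
  The value \<open>c\<close> is \<open>-(\<pi>/2) ln 2\<close>, but only the symmetries of \<open>ln \<bar>sin\<bar>\<close> matter: in
  \<open>ln_tan_square_diff_integral\<close> all multiples of \<open>c\<close> cancel.
\<close>

lemma has_integral_ln_sin:
  defines "c \<equiv> integral {0..pi/2} ln_sin"
  shows "(ln_sin has_integral c) {0..pi/2}" "(ln_sin has_integral c) {-(pi/2)..0}"
    "(ln_sin has_integral c) {pi/2..pi}"
proof -
  show 1: "(ln_sin has_integral c) {0..pi/2}"
    unfolding c_def using integrable_ln_sin_quarter
    by (intro integrable_integral set_lebesgue_integral_eq_integral(1))
  show 2: "(ln_sin has_integral c) {-(pi/2)..0}"
    using has_integral_reflect_lemma_real[OF 1] unfolding ln_sin_minus by simp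
  show "(ln_sin has_integral c) {pi/2..pi}"
    using has_integral_shift_real_ivl[OF 2, of "-pi"] unfolding ln_sin_diff_pi by simp
qed

lemma has_integral_ln_cos:
  "((\<lambda>x. ln \<bar>cos x\<bar>) has_integral integral {0..pi/2} ln_sin) {0..pi/2}"
proof -
  have "ln_sin (x + pi/2) = ln \<bar>cos x\<bar>" for x
    by (simp add: ln_sin_def sin_add)
  then show ?thesis
    using has_integral_shift_real_ivl[OF has_integral_ln_sin(3), of "pi/2"] by simp
qed

text \<open>
  After a reflection of the first integral, the two integrals together cover
  \<open>[y-\<pi>/2, y+\<pi>/2]\<close>, a full period of \<open>ln \<bar>sin\<bar>\<close>.
\<close>

lemma has_integral_ln_sin_shifted_pair:
  assumes "0 \<le> y" "y < pi / 2"
  shows "(\<lambda>x. ln_sin (x + - y)) integrable_on {0..pi/2}" "(\<lambda>x. ln_sin (x + y)) integrable_on {0..pi/2}"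
    "integral {0..pi/2} (\<lambda>x. ln_sin (x + - y)) + integral {0..pi/2} (\<lambda>x. ln_sin (x + y))
      = 2 * integral {0..pi/2} ln_sin"
proof -
  define c where "c = integral {0..pi/2} ln_sin"
  have "ln_sin integrable_on {-(pi/2)..pi/2}"
    by (rule Henstock_Kurzweil_Integration.integrable_combine[of _ 0])
      (use has_integral_ln_sin in \<open>auto intro: has_integral_integrable\<close>)
  then have int: "ln_sin integrable_on {-(pi/2)..pi}"
    by (rule Henstock_Kurzweil_Integration.integrable_combine[of _ "pi/2", rotated 2])
      (use has_integral_ln_sin in \<open>auto intro: has_integral_integrable\<close>)
  have sub: "ln_sin integrable_on {a..b}" if "-(pi/2) \<le> a" "b \<le> pi" for a b
    using int by (rule integrable_on_subinterval) (use that in auto)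
  have plus: "((\<lambda>x. ln_sin (x + y)) has_integral integral {y..y+pi/2} ln_sin) {0..pi/2}"
    using has_integral_shift_real_ivl[OF integrable_integral[OF sub, of y "y+pi/2"], of y] assms by simp
  have "(ln_sin has_integral integral {y-pi/2..y} ln_sin) {-y..pi/2-y}"
    using has_integral_reflect_lemma_real[OF integrable_integral[OF sub, of "y-pi/2" y]] assms
    unfolding ln_sin_minus by simp
  from has_integral_shift_real_ivl[OF this, of "-y"]
  have minus: "((\<lambda>x. ln_sin (x + - y)) has_integral integral {y-pi/2..y} ln_sin) {0..pi/2}"
    by simp
  \<comment> \<open>By periodicity the part of the interval left of \<open>0\<close> may be moved to the right end.\<close>
  have "(ln_sin has_integral integral {y-pi/2..0} ln_sin) {y+pi/2..pi}"
    using has_integral_shift_real_ivl[OF integrable_integral[OF sub, of "y-pi/2" 0], of "-pi"] assms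
    unfolding ln_sin_diff_pi by (simp add: algebra_simps)
  then have "integral {y-pi/2..0} ln_sin = integral {y+pi/2..pi} ln_sin"
    by (simp add: integral_unique)
  moreover have "integral {y-pi/2..y} ln_sin = integral {y-pi/2..0} ln_sin + integral {0..y} ln_sin"
    by (rule Henstock_Kurzweil_Integration.integral_combine[symmetric]) (use assms in \<open>auto intro: sub\<close>)
  moreover have "integral {0..y} ln_sin + integral {y..y+pi/2} ln_sin = integral {0..y+pi/2} ln_sin"
    by (rule Henstock_Kurzweil_Integration.integral_combine) (use assms in \<open>auto intro: sub\<close>)
  moreover have "integral {0..y+pi/2} ln_sin + integral {y+pi/2..pi} ln_sin = integral {0..pi} ln_sin"
    by (rule Henstock_Kurzweil_Integration.integral_combine) (use assms in \<open>auto intro: sub\<close>)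
  moreover have "integral {0..pi/2} ln_sin + integral {pi/2..pi} ln_sin = integral {0..pi} ln_sin"
    by (rule Henstock_Kurzweil_Integration.integral_combine) (auto intro: sub)
  moreover have "integral {pi/2..pi} ln_sin = c"
    using has_integral_ln_sin(3) by (simp add: c_def integral_unique)
  ultimately have sum: "integral {y-pi/2..y} ln_sin + integral {y..y+pi/2} ln_sin = 2 * c"
    unfolding c_def by linarith
  show "(\<lambda>x. ln_sin (x + - y)) integrable_on {0..pi/2}" "(\<lambda>x. ln_sin (x + y)) integrable_on {0..pi/2}"
    using plus minus by (auto intro: has_integral_integrable)
  show "integral {0..pi/2} (\<lambda>x. ln_sin (x + - y)) + integral {0..pi/2} (\<lambda>x. ln_sin (x + y))
      = 2 * integral {0..pi/2} ln_sin"
    using sum unfolding integral_unique[OF plus] integral_unique[OF minus] c_def by simp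
qed

lemma ln_tan_square_diff:
  assumes "0 \<le> x" "x < pi / 2" "0 \<le> y" "y < pi / 2" "x \<noteq> y"
  shows "ln \<bar>(tan x)\<^sup>2 - (tan y)\<^sup>2\<bar> = ln_sin (x + - y) + ln_sin (x + y) - 2 * ln \<bar>cos x\<bar> - 2 * ln \<bar>cos y\<bar>"
proof -
  have pos: "cos x > 0" "cos y > 0" using assms by (auto intro!: cos_gt_zero_pi)
  have "(tan x)\<^sup>2 - (tan y)\<^sup>2 = (tan x - tan y) * (tan x + tan y)"
    by (simp add: power2_eq_square algebra_simps)
  also have "\<dots> = sin (x - y) * sin (x + y) / ((cos x)\<^sup>2 * (cos y)\<^sup>2)"
    using pos by (simp add: tan_def sin_diff sin_add power2_eq_square divide_simps) (simp add: algebra_simps)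
  finally have eq: "\<bar>(tan x)\<^sup>2 - (tan y)\<^sup>2\<bar> = \<bar>sin (x - y)\<bar> * \<bar>sin (x + y)\<bar> / ((cos x)\<^sup>2 * (cos y)\<^sup>2)"
    by (simp add: abs_mult)
  have "sin (x - y) \<noteq> 0"
    using sin_eq_0_pi[of "x - y"] assms by auto
  moreover have "sin (x + y) > 0"
    using assms by (intro sin_gt_zero) auto
  ultimately show ?thesis
    unfolding eq using pos by (simp add: ln_mult ln_div ln_realpow ln_sin_def)
qed

text \<open>
  With \<open>s = tan\<^sup>2 y\<close> one has
  \<open>tan\<^sup>2 x - tan\<^sup>2 y = sin (x-y) sin (x+y) / (cos\<^sup>2 x cos\<^sup>2 y)\<close>. The integrals of the sine factors and of
  \<open>cos x\<close> cancel, and \<open>1/cos\<^sup>2 y = 1 + s\<close> remains. After the substitution \<open>t = tan x\<close> this is the mean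
  value property at \<open>z = \<i>\<close> of \<open>ln \<bar>z\<^sup>2 - s\<bar>\<close>, which is harmonic in the upper half-plane.
\<close>

lemma ln_tan_square_diff_integral:
  assumes "s \<ge> 0"
  shows "(\<lambda>x. ln \<bar>(tan x)\<^sup>2 - s\<bar>) absolutely_integrable_on {0<..<pi/2}"
    and "integral {0<..<pi/2} (\<lambda>x. ln \<bar>(tan x)\<^sup>2 - s\<bar>) = pi / 2 * ln (1 + s)"
proof -
  define y where "y = arctan (sqrt s)"
  have y: "0 \<le> y" "y < pi / 2" "(tan y)\<^sup>2 = s"
    using assms arctan_ubound[of "sqrt s"] by (auto simp: y_def tan_arctan)
  have cy: "cos y > 0" using y by (auto intro!: cos_gt_zero_pi)
  let ?g = "\<lambda>x. ln_sin (x + - y) + ln_sin (x + y) - 2 * ln \<bar>cos x\<bar> - 2 * ln \<bar>cos y\<bar>"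
  have abs1: "f absolutely_integrable_on {0..pi/2}"
    if "f integrable_on {0..pi/2}" "\<And>x. f x \<le> 0" for f :: "real \<Rightarrow> real"
  proof -
    have "(\<lambda>x. - f x) absolutely_integrable_on {0..pi/2}"
      by (rule nonnegative_absolutely_integrable_1) (use that in \<open>auto intro: integrable_neg\<close>)
    then show ?thesis
      using set_integrable_mult_right[of "-1" lebesgue _ "\<lambda>x. - f x"] by simp
  qed
  have ai: "?g absolutely_integrable_on {0..pi/2}"
    by (intro set_integral_diff set_integral_add set_integrable_mult_right abs1
        has_integral_ln_sin_shifted_pair[OF y(1,2)] ln_sin_nonpos ln_cos_nonpos
        has_integral_integrable[OF has_integral_ln_cos] absolutely_integrable_on_const) auto
  have "integral {0..pi/2} ?g = 2 * integral {0..pi/2} ln_sin - 2 * integral {0..pi/2} ln_sin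
      - pi / 2 * (2 * ln \<bar>cos y\<bar>)"
  proof -
    have "(?g has_integral (integral {0..pi/2} (\<lambda>x. ln_sin (x + - y)) + integral {0..pi/2} (\<lambda>x. ln_sin (x + y))
        - 2 * integral {0..pi/2} ln_sin - (pi / 2 - 0) *\<^sub>R (2 * ln \<bar>cos y\<bar>))) {0..pi/2}"
      by (intro has_integral_diff has_integral_add has_integral_mult_right has_integral_ln_cos
          integrable_integral has_integral_ln_sin_shifted_pair[OF y(1,2)])
        (use has_integral_const_real[of "2 * ln \<bar>cos y\<bar>" 0 "pi/2"] in simp)
    then show ?thesis
      unfolding has_integral_ln_sin_shifted_pair(3)[OF y(1,2)] by (simp add: integral_unique)
  qed
  also have "\<dots> = pi / 2 * ln (1 + s)"
  proof -
    have "1 + s = inverse ((cos y)\<^sup>2)"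
      using tan_sec[of y] cy y by (simp add: power_inverse)
    then show ?thesis using cy by (simp add: ln_inverse ln_realpow)
  qed
  finally have I: "integral {0..pi/2} ?g = pi / 2 * ln (1 + s)" .
  have eq: "ln \<bar>(tan x)\<^sup>2 - s\<bar> = ?g x" if "x \<in> {0..pi/2} - {y, pi/2}" for x
    using ln_tan_square_diff[of x y] that y by auto
  have neg: "negligible {y, pi/2}" by simp
  have "(\<lambda>x. ln \<bar>(tan x)\<^sup>2 - s\<bar>) absolutely_integrable_on {0..pi/2}"
    by (rule absolutely_integrable_spike[OF ai neg eq])
  then show "(\<lambda>x. ln \<bar>(tan x)\<^sup>2 - s\<bar>) absolutely_integrable_on {0<..<pi/2}"
    using absolutely_integrable_on_open_interval[of 0 "pi/2" "\<lambda>x. ln \<bar>(tan x)\<^sup>2 - s\<bar>"]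
    unfolding cbox_interval box_real by blast
  have "integral {0..pi/2} (\<lambda>x. ln \<bar>(tan x)\<^sup>2 - s\<bar>) = integral {0..pi/2} ?g"
    by (rule integral_spike[OF neg]) (use eq in auto)
  then show "integral {0<..<pi/2} (\<lambda>x. ln \<bar>(tan x)\<^sup>2 - s\<bar>) = pi / 2 * ln (1 + s)"
    using I by (simp only: integral_open_interval_real)
qed

lemma ln_one_plus_tan_square_integrable:
  "(\<lambda>x. ln (1 + (tan x)\<^sup>2)) absolutely_integrable_on {0<..<pi/2}"
proof -
  have eq: "-2 * ln \<bar>cos x\<bar> = ln (1 + (tan x)\<^sup>2)" if "x \<in> {0<..<pi/2}" for x
  proof -
    have "cos x > 0" using that by (auto intro!: cos_gt_zero_pi)
    then show ?thesis
      using tan_sec[of x] by (simp add: power_inverse[symmetric] ln_inverse ln_realpow)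
  qed
  have "(\<lambda>x. -2 * ln \<bar>cos x\<bar>) integrable_on {0..pi/2}"
    using has_integral_ln_cos by (intro integrable_on_mult_right) (rule has_integral_integrable)
  then have "(\<lambda>x. -2 * ln \<bar>cos x\<bar>) absolutely_integrable_on {0<..<pi/2}"
    by (intro nonnegative_absolutely_integrable_1)
      (use ln_cos_nonpos in \<open>auto simp: integrable_on_open_interval_real[symmetric]\<close>)
  then show ?thesis
    by (subst set_integrable_cong[OF refl refl eq[symmetric]]) auto
qed

section \<open>Logarithms of polynomials under the half-Cauchy distribution\<close>

definition half_cauchy :: "real measure" where
  "half_cauchy = density lborel (\<lambda>t. ennreal (indicator {0<..} t * (2 / pi) / (1 + t\<^sup>2)))"

lemma sets_half_cauchy [simp, measurable_cong]: "sets half_cauchy = sets borel"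
  by (simp add: half_cauchy_def)

lemma space_half_cauchy [simp]: "space half_cauchy = UNIV"
  by (simp add: half_cauchy_def)

lemma AE_half_cauchy_iff:
  assumes [measurable]: "Measurable.pred borel P"
  shows "(AE t in half_cauchy. P t) \<longleftrightarrow> (AE t in lborel. t > 0 \<longrightarrow> P t)"
proof -
  have "0 < ennreal (indicator {0<..} t * (2 / pi) / (1 + t\<^sup>2)) \<longleftrightarrow> t > 0" for t :: real
    by (auto simp: indicator_def divide_simps add_pos_nonneg)
  then show ?thesis
    unfolding half_cauchy_def by (subst AE_density) auto
qed

lemma integrable_half_cauchy_iff:
  fixes F :: "real \<Rightarrow> real"
  assumes [measurable]: "F \<in> borel_measurable borel"
  shows "integrable half_cauchy F \<longleftrightarrow> set_integrable lborel {0<..} (\<lambda>t. F t / (1 + t\<^sup>2))"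
    and "integral\<^sup>L half_cauchy F = 2 / pi * (LINT t:{0<..}|lborel. F t / (1 + t\<^sup>2))"
proof -
  have eq: "(indicator {0<..} t * (2 / pi) / (1 + t\<^sup>2)) *\<^sub>R F t =
      2 / pi * (indicator {0<..} t *\<^sub>R (F t / (1 + t\<^sup>2)))" for t :: real
    by (simp add: field_simps)
  show "integrable half_cauchy F \<longleftrightarrow> set_integrable lborel {0<..} (\<lambda>t. F t / (1 + t\<^sup>2))"
  proof -
    have "integrable half_cauchy F \<longleftrightarrow>
        integrable lborel (\<lambda>t. 2 / pi * (indicator {0<..} t *\<^sub>R (F t / (1 + t\<^sup>2))))"
      unfolding half_cauchy_def eq[symmetric] by (rule integrable_density) auto
    also have "\<dots> \<longleftrightarrow> set_integrable lborel {0<..} (\<lambda>t. F t / (1 + t\<^sup>2))"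
      unfolding set_integrable_def by (subst integrable_mult_left_iff) simp
    finally show ?thesis .
  qed
  show "integral\<^sup>L half_cauchy F = 2 / pi * (LINT t:{0<..}|lborel. F t / (1 + t\<^sup>2))"
  proof -
    have "integral\<^sup>L half_cauchy F =
        integral\<^sup>L lborel (\<lambda>t. 2 / pi * (indicator {0<..} t *\<^sub>R (F t / (1 + t\<^sup>2))))"
      unfolding half_cauchy_def eq[symmetric] by (rule integral_density) auto
    then show ?thesis unfolding set_lebesgue_integral_def integral_mult_right_zero .
  qed
qed

lemma absolutely_integrable_on_borel:
  fixes F :: "real \<Rightarrow> real"
  assumes [measurable]: "F \<in> borel_measurable borel" "S \<in> sets borel"
  shows "F absolutely_integrable_on S \<longleftrightarrow> set_integrable lborel S F"
    and "set_integrable lborel S F \<Longrightarrow> (LINT t:S|lborel. F t) = integral S F"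
proof -
  show iff: "F absolutely_integrable_on S \<longleftrightarrow> set_integrable lborel S F"
    unfolding set_integrable_def by (rule integrable_completion) measurable
  assume *: "set_integrable lborel S F"
  have "(LINT t:S|lborel. F t) = (LINT t:S|lebesgue. F t)"
    unfolding set_lebesgue_integral_def by (rule integral_completion[symmetric]) measurable
  also have "\<dots> = integral S F"
    using iff * by (intro set_lebesgue_integral_eq_integral(2)) simp
  finally show "(LINT t:S|lborel. F t) = integral S F" .
qed

lemma tan_image_quarter: "tan ` {0<..<pi/2} = {0<..}"
proof safe
  fix x :: real assume "x > 0"
  then show "x \<in> tan ` {0<..<pi/2}"
    using arctan_ubound[of x] by (intro image_eqI[of _ _ "arctan x"]) (auto simp: tan_arctan)
qed (auto intro: tan_gt_zero)

text \<open>
  The half-Cauchy distribution is the image of the uniform distribution on \<open>]0,\<pi>/2[\<close> under the tangent.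
\<close>

lemma half_cauchy_tan:
  fixes F :: "real \<Rightarrow> real"
  assumes [measurable]: "F \<in> borel_measurable borel"
    and int: "(\<lambda>x. F (tan x)) absolutely_integrable_on {0<..<pi/2}"
  shows "integrable half_cauchy F"
    and "integral\<^sup>L half_cauchy F = 2 / pi * integral {0<..<pi/2} (\<lambda>x. F (tan x))"
proof -
  let ?f = "\<lambda>t. F t / (1 + t\<^sup>2)" and ?D = "{0<..<pi/2}"
  have c: "cos x > 0" if "x \<in> ?D" for x using that by (auto intro!: cos_gt_zero_pi)
  have eq: "\<bar>inverse ((cos x)\<^sup>2)\<bar> * ?f (tan x) = F (tan x)" if "x \<in> ?D" for x
  proof -
    have "\<bar>inverse ((cos x)\<^sup>2)\<bar> = 1 + (tan x)\<^sup>2"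
      using c[OF that] tan_sec[of x] by (simp add: power_inverse)
    moreover have "1 + (tan x)\<^sup>2 \<noteq> 0" by (smt (verit) zero_le_power2)
    ultimately show ?thesis by simp
  qed
  have inj: "inj_on tan ?D"
    by (rule inj_on_inverseI[of _ arctan]) (auto intro: arctan_tan)
  have der: "(tan has_field_derivative inverse ((cos x)\<^sup>2)) (at x within ?D)" if "x \<in> ?D" for x
    using DERIV_tan[of x] c[OF that] by (auto intro: has_field_derivative_at_within)
  have "?f absolutely_integrable_on tan ` ?D \<and> integral (tan ` ?D) ?f = integral ?D (\<lambda>x. F (tan x))"
  proof (subst has_absolute_integral_change_of_variables_1'[OF _ der inj, symmetric])
    have "(\<lambda>x. \<bar>inverse ((cos x)\<^sup>2)\<bar> * ?f (tan x)) absolutely_integrable_on ?D"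
      using int by (subst set_integrable_cong[OF refl refl eq]) auto
    moreover have "integral ?D (\<lambda>x. \<bar>inverse ((cos x)\<^sup>2)\<bar> * ?f (tan x)) = integral ?D (\<lambda>x. F (tan x))"
      by (rule integral_cong) (rule eq)
    ultimately show "(\<lambda>x. \<bar>inverse ((cos x)\<^sup>2)\<bar> * ?f (tan x)) absolutely_integrable_on ?D \<and>
      integral ?D (\<lambda>x. \<bar>inverse ((cos x)\<^sup>2)\<bar> * ?f (tan x)) = integral ?D (\<lambda>x. F (tan x))" ..
  qed auto
  then have f: "?f absolutely_integrable_on {0<..}"
    "integral {0<..} ?f = integral ?D (\<lambda>x. F (tan x))"
    unfolding tan_image_quarter by auto
  have m: "?f \<in> borel_measurable borel" by measurable
  have si: "set_integrable lborel {0<..} ?f"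
    using absolutely_integrable_on_borel(1)[OF m] f(1) by simp
  then show "integrable half_cauchy F" by (simp add: integrable_half_cauchy_iff(1))
  show "integral\<^sup>L half_cauchy F = 2 / pi * integral ?D (\<lambda>x. F (tan x))"
    unfolding integrable_half_cauchy_iff(2)[OF assms(1)]
    using absolutely_integrable_on_borel(2)[OF m _ si] f(2) by simp
qed

lemma prob_space_half_cauchy: "prob_space half_cauchy"
proof
  have "integral\<^sup>L half_cauchy (\<lambda>_. 1 :: real) = 2 / pi * integral {0<..<pi/2} (\<lambda>_. 1)"
    using absolutely_integrable_on_open_interval[of 0 "pi/2" "\<lambda>_. 1::real"]
    by (intro half_cauchy_tan(2)) (auto intro: absolutely_integrable_on_const)
  also have "\<dots> = 1" by (simp flip: integral_open_interval_real)
  finally show "emeasure half_cauchy (space half_cauchy) = 1"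
    by (cases "emeasure half_cauchy UNIV" rule: ennreal_cases) (auto simp: measure_def)
qed

interpretation half_cauchy: prob_space half_cauchy by (rule prob_space_half_cauchy)

lemma half_cauchy_ln_square_minus_nonneg:
  assumes "s \<ge> 0"
  shows "integrable half_cauchy (\<lambda>t. ln \<bar>t\<^sup>2 - s\<bar>)"
    and "half_cauchy.expectation (\<lambda>t. ln \<bar>t\<^sup>2 - s\<bar>) = ln (1 + s)"
  using half_cauchy_tan[of "\<lambda>t. ln \<bar>t\<^sup>2 - s\<bar>"] ln_tan_square_diff_integral[OF assms] by auto

lemma half_cauchy_ln_one_plus_square: "integrable half_cauchy (\<lambda>t. ln (1 + t\<^sup>2))"
  using half_cauchy_tan[of "\<lambda>t. ln (1 + t\<^sup>2)"] ln_one_plus_tan_square_integrable by auto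

lemma AE_half_cauchy_pos: "AE t in half_cauchy. t > 0"
  by (subst AE_half_cauchy_iff) auto

lemma AE_half_cauchy_notin_finite:
  assumes "finite S" shows "AE t in half_cauchy. t \<notin> S"
proof -
  have [measurable]: "S \<in> sets borel" using assms by (intro borel_closed finite_imp_closed)
  have "AE t in lborel. t \<notin> S"
    using assms by (intro AE_not_in finite_imp_null_set_lborel)
  then show ?thesis by (subst AE_half_cauchy_iff) auto
qed

text \<open>
  Moving the zero \<open>a\<close> to \<open>\<bar>a\<bar> \<ge> 0\<close> does not increase \<open>\<bar>u - a\<bar>\<close> for any \<open>u \<ge> 0\<close> and does not
  decrease \<open>\<bar>-1 - a\<bar>\<close>, so the case of a nonnegative zero, in which equality holds, is the worst.
\<close>

lemma half_cauchy_ln_cmod_linear: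
  fixes a :: complex
  shows "integrable half_cauchy (\<lambda>t. ln (cmod (of_real (t\<^sup>2) - a)))"
    and "a \<noteq> -1 \<Longrightarrow> ln (cmod (- 1 - a)) \<le> half_cauchy.expectation (\<lambda>t. ln (cmod (of_real (t\<^sup>2) - a)))"
proof -
  let ?F = "\<lambda>t. ln (cmod (of_real (t\<^sup>2) - a))" and ?G = "\<lambda>t. ln \<bar>t\<^sup>2 - cmod a\<bar>"
  have AE: "AE t in half_cauchy. ?G t \<le> ?F t \<and> ?F t \<le> ln (1 + t\<^sup>2) + ln (1 + cmod a)"
    using AE_half_cauchy_pos AE_half_cauchy_notin_finite[of "{sqrt (cmod a)}", simplified]
  proof eventually_elim
    case (elim t)
    then have ne: "t\<^sup>2 \<noteq> cmod a" by (metis real_sqrt_unique less_imp_le)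
    have le: "\<bar>t\<^sup>2 - cmod a\<bar> \<le> cmod (of_real (t\<^sup>2) - a)"
      using norm_triangle_ineq3[of "of_real (t\<^sup>2)" a] by (simp add: norm_power)
    have "cmod (of_real (t\<^sup>2) - a) \<le> t\<^sup>2 + cmod a"
      using norm_triangle_ineq4[of "of_real (t\<^sup>2)" a] by (simp add: norm_power)
    also have "\<dots> \<le> (1 + t\<^sup>2) * (1 + cmod a)"
      by (simp add: algebra_simps)
    finally have "ln (cmod (of_real (t\<^sup>2) - a)) \<le> ln ((1 + t\<^sup>2) * (1 + cmod a))"
      using le ne by (intro ln_mono) auto
    also have "\<dots> = ln (1 + t\<^sup>2) + ln (1 + cmod a)"
      by (rule ln_mult_pos) (auto simp: add_pos_nonneg)
    finally have "?F t \<le> ln (1 + t\<^sup>2) + ln (1 + cmod a)" .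
    moreover have "?G t \<le> ?F t"
      using le ne by (intro ln_mono) auto
    ultimately show ?case by simp
  qed
  show int: "integrable half_cauchy ?F"
  proof (rule Bochner_Integration.integrable_bound)
    show "integrable half_cauchy (\<lambda>t. \<bar>?G t\<bar> + (\<bar>ln (1 + t\<^sup>2)\<bar> + \<bar>ln (1 + cmod a)\<bar>))"
      by (intro Bochner_Integration.integrable_add integrable_abs half_cauchy_ln_square_minus_nonneg
          half_cauchy_ln_one_plus_square) auto
    show "AE t in half_cauchy. norm (?F t) \<le> norm (\<bar>?G t\<bar> + (\<bar>ln (1 + t\<^sup>2)\<bar> + \<bar>ln (1 + cmod a)\<bar>))"
      using AE by eventually_elim (unfold real_norm_def, linarith)
  qed measurable
  assume a: "a \<noteq> -1"
  have "cmod (- 1 - a) > 0" using a by (auto simp: add_eq_0_iff2 algebra_simps)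
  moreover have "cmod (- 1 - a) \<le> 1 + cmod a"
    using norm_triangle_ineq4[of "- 1" a] by simp
  ultimately have "ln (cmod (- 1 - a)) \<le> ln (1 + cmod a)" by (intro ln_mono) auto
  also have "\<dots> = half_cauchy.expectation ?G"
    using half_cauchy_ln_square_minus_nonneg(2)[of "cmod a"] by simp
  also have "\<dots> \<le> half_cauchy.expectation ?F"
    using AE by (intro integral_mono_AE half_cauchy_ln_square_minus_nonneg(1) int) auto
  finally show "ln (cmod (- 1 - a)) \<le> half_cauchy.expectation ?F" .
qed

text \<open>
  Both sides of the inequality are additive over the linear factors of \<open>Q\<close>.
\<close>

lemma half_cauchy_ln_cmod_poly:
  fixes Q :: "complex poly"
  assumes "poly Q (- 1) \<noteq> 0"
  shows "integrable half_cauchy (\<lambda>t. ln (cmod (poly Q (of_real (t\<^sup>2)))))" (is ?int)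
    and "ln (cmod (poly Q (- 1))) \<le> half_cauchy.expectation (\<lambda>t. ln (cmod (poly Q (of_real (t\<^sup>2)))))" (is ?le)
    and "AE t in half_cauchy. poly Q (of_real (t\<^sup>2)) \<noteq> 0" (is ?ae)
proof -
  have "Q \<noteq> 0" using assms by auto
  then obtain A where A: "Q = smult (lead_coeff Q) (\<Prod>x\<in>#A. [:-x, 1:])"
    using alg_closed_imp_factorization[of Q] by blast
  define R where "R B = smult (lead_coeff Q) (\<Prod>x\<in>#B. [:-x, 1:])" for B
  have "poly (R B) (- 1) \<noteq> 0 \<Longrightarrow>
      integrable half_cauchy (\<lambda>t. ln (cmod (poly (R B) (of_real (t\<^sup>2))))) \<and>
      ln (cmod (poly (R B) (- 1))) \<le> half_cauchy.expectation (\<lambda>t. ln (cmod (poly (R B) (of_real (t\<^sup>2))))) \<and>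
      (AE t in half_cauchy. poly (R B) (of_real (t\<^sup>2)) \<noteq> 0)" for B
  proof (induction B)
    case empty
    then show ?case using \<open>Q \<noteq> 0\<close> half_cauchy.prob_space by (simp add: R_def)
  next
    case (add a B)
    have RB: "R (add_mset a B) = [:-a, 1:] * R B" by (simp add: R_def)
    have pRB: "poly (R (add_mset a B)) z = (z - a) * poly (R B) z" for z
      by (simp add: RB algebra_simps)
    have a: "a \<noteq> -1" and B: "poly (R B) (- 1) \<noteq> 0" using add.prems by (auto simp: RB)
    note IH = add.IH[OF B]
    let ?F = "\<lambda>t. ln (cmod (of_real (t\<^sup>2) - a))" and ?G = "\<lambda>t. ln (cmod (poly (R B) (of_real (t\<^sup>2))))"
    let ?H = "\<lambda>t. ln (cmod (poly (R (add_mset a B)) (of_real (t\<^sup>2))))"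
    have [measurable]: "(\<lambda>t::real. poly q (of_real (t\<^sup>2))) \<in> borel_measurable borel" for q :: "complex poly"
      by (intro borel_measurable_continuous_onI continuous_intros)
    have "finite {t. of_real (t\<^sup>2) = a}"
      by (rule finite_subset[of _ "{sqrt (Re a), - sqrt (Re a)}"]) (auto simp: power2_eq_iff)
    from AE_half_cauchy_notin_finite[OF this] IH
    have AE: "AE t in half_cauchy. of_real (t\<^sup>2) \<noteq> a \<and> poly (R B) (of_real (t\<^sup>2)) \<noteq> 0" by auto
    then have ne: "AE t in half_cauchy. poly (R (add_mset a B)) (of_real (t\<^sup>2)) \<noteq> 0"
      by (auto simp: RB)
    have eq: "AE t in half_cauchy. ?F t + ?G t = ?H t"
      using AE by eventually_elim (simp add: pRB norm_mult ln_mult)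
    have sum: "integrable half_cauchy (\<lambda>t. ?F t + ?G t)"
      using IH half_cauchy_ln_cmod_linear by (intro Bochner_Integration.integrable_add) auto
    have int: "integrable half_cauchy ?H"
      by (rule integrable_cong_AE_imp[OF sum]; (rule eq | measurable))
    have "ln (cmod (poly (R (add_mset a B)) (- 1))) = ln (cmod (- 1 - a)) + ln (cmod (poly (R B) (- 1)))"
    proof -
      have "- 1 - a \<noteq> 0" using a by (metis eq_iff_diff_eq_0)
      then show ?thesis using B unfolding pRB norm_mult by (intro ln_mult_pos) auto
    qed
    also have "\<dots> \<le> half_cauchy.expectation ?F + half_cauchy.expectation ?G"
      using half_cauchy_ln_cmod_linear(2)[OF a] IH by (intro add_mono) auto
    also have "\<dots> = half_cauchy.expectation (\<lambda>t. ?F t + ?G t)"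
      using IH half_cauchy_ln_cmod_linear by (intro Bochner_Integration.integral_add[symmetric]) auto
    also have "\<dots> = half_cauchy.expectation ?H"
      by (rule integral_cong_AE; (rule eq | measurable))
    finally show ?case using int ne by blast
  qed
  from this[of A] show ?int ?le ?ae
    using assms A unfolding R_def by auto
qed

section \<open>Laurent polynomials stay away from the resolvent\<close>

text \<open>
  One has \<open>D(u) = \<bar>q(u)\<bar> / (u\<^sup>N (1+u))\<close> with the polynomial \<open>q(u) = u\<^sup>N - (1+u) p(u)\<close>, and
  \<open>\<bar>q(-1)\<bar> = 1\<close> whatever \<open>p\<close> is. Moreover \<open>ln t\<^sup>2\<close> has mean \<open>0\<close>, so the bound depends
  neither on \<open>p\<close> nor on \<open>N\<close>.
\<close>

lemma half_cauchy_ln_resolvent_minus_rational: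
  fixes p :: "real poly" and N :: nat
  defines "D \<equiv> \<lambda>u. \<bar>1 / (1 + u) - poly p u / u ^ N\<bar>"
  shows "integrable half_cauchy (\<lambda>t. ln (D (t\<^sup>2)))"
    and "- half_cauchy.expectation (\<lambda>t. ln (1 + t\<^sup>2)) \<le> half_cauchy.expectation (\<lambda>t. ln (D (t\<^sup>2)))"
    and "AE t in half_cauchy. D (t\<^sup>2) > 0"
proof -
  define q where "q = monom 1 N - [:1, 1:] * p"
  define Q :: "complex poly" where "Q = map_poly of_real q"
  have Q: "poly Q (of_real x) = of_real (poly q x)" for x
    unfolding Q_def by (induction q) (auto simp: map_poly_pCons)
  have "poly Q (- 1) = of_real (poly q (- 1))" using Q[of "- 1"] by simp
  also have "poly q (- 1) = (- 1) ^ N" by (simp add: q_def poly_monom)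
  finally have Q1: "poly Q (- 1) = (- 1) ^ N" by simp
  have nz: "poly Q (- 1) \<noteq> 0" and ln0: "ln (cmod (poly Q (- 1))) = 0"
    by (simp_all add: Q1 norm_power)
  note Qq = half_cauchy_ln_cmod_poly[OF nz, unfolded Q norm_of_real ln0]
  have [measurable]: "(\<lambda>t::real. poly r t) \<in> borel_measurable borel" for r :: "real poly"
    by (intro borel_measurable_continuous_onI continuous_intros)
  have D_eq: "D (t\<^sup>2) = \<bar>poly q (t\<^sup>2)\<bar> / ((t\<^sup>2) ^ N * (1 + t\<^sup>2))" if "t > 0" for t
  proof -
    have "1 + t\<^sup>2 > 0" "(t\<^sup>2) ^ N > 0" using that by (auto simp: add_pos_nonneg)
    then have "1 / (1 + t\<^sup>2) - poly p (t\<^sup>2) / (t\<^sup>2) ^ N = poly q (t\<^sup>2) / ((t\<^sup>2) ^ N * (1 + t\<^sup>2))"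
    proof -
      have "1 / s - P / z = (z - s * P) / (z * s)" if "s > 0" "z > 0" for s P z :: real
        using that by (simp add: field_simps)
      moreover have "poly q (t\<^sup>2) = (t\<^sup>2) ^ N - (1 + t\<^sup>2) * poly p (t\<^sup>2)"
        by (simp add: q_def poly_monom distrib_right)
      ultimately show ?thesis using \<open>1 + t\<^sup>2 > 0\<close> \<open>(t\<^sup>2) ^ N > 0\<close> by metis
    qed
    with \<open>1 + t\<^sup>2 > 0\<close> \<open>(t\<^sup>2) ^ N > 0\<close> show ?thesis by (simp add: D_def abs_mult)
  qed
  show "AE t in half_cauchy. D (t\<^sup>2) > 0"
    using AE_half_cauchy_pos Qq(3)
  proof eventually_elim
    case (elim t)
    then have "1 + t\<^sup>2 > 0" "(t\<^sup>2) ^ N > 0" by (auto simp: add_pos_nonneg)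
    then show ?case unfolding D_eq[OF elim(1)] using elim by simp
  qed
  let ?S = "\<lambda>t. ln \<bar>poly q (t\<^sup>2)\<bar> - real N * ln \<bar>t\<^sup>2 - 0\<bar> - ln (1 + t\<^sup>2)"
  have eq: "AE t in half_cauchy. ?S t = ln (D (t\<^sup>2))"
    using AE_half_cauchy_pos Qq(3)
  proof eventually_elim
    case (elim t)
    then have "1 + t\<^sup>2 > 0" "(t\<^sup>2) ^ N > 0" by (auto simp: add_pos_nonneg)
    then show ?case unfolding D_eq[OF elim(1)]
      using elim by (simp add: ln_mult_pos ln_div ln_realpow)
  qed
  have m: "(\<lambda>t. ln (D (t\<^sup>2))) \<in> borel_measurable half_cauchy"
    unfolding D_def by measurable
  have parts: "integrable half_cauchy (\<lambda>t. ln \<bar>poly q (t\<^sup>2)\<bar>)"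
    "integrable half_cauchy (\<lambda>t. real N * ln \<bar>t\<^sup>2 - 0\<bar>)" "integrable half_cauchy (\<lambda>t. ln (1 + t\<^sup>2))"
    by (intro Qq(1) integrable_mult_right half_cauchy_ln_square_minus_nonneg(1)
        half_cauchy_ln_one_plus_square order_refl)+
  then have S: "integrable half_cauchy ?S"
    by (intro Bochner_Integration.integrable_diff)
  then show "integrable half_cauchy (\<lambda>t. ln (D (t\<^sup>2)))"
    by (rule integrable_cong_AE_imp[OF _ m]) (use eq in auto)
  have "half_cauchy.expectation (\<lambda>t. ln (D (t\<^sup>2))) = half_cauchy.expectation ?S"
    by (rule integral_cong_AE[OF m]) (use S eq in auto)
  also have "\<dots> = half_cauchy.expectation (\<lambda>t. ln \<bar>poly q (t\<^sup>2)\<bar>)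
      - real N * half_cauchy.expectation (\<lambda>t. ln \<bar>t\<^sup>2 - 0\<bar>) - half_cauchy.expectation (\<lambda>t. ln (1 + t\<^sup>2))"
    using parts by (simp only: Bochner_Integration.integral_diff Bochner_Integration.integrable_diff
        integral_mult_right_zero)
  also have "half_cauchy.expectation (\<lambda>t. ln \<bar>t\<^sup>2 - 0\<bar>) = 0"
    by (subst half_cauchy_ln_square_minus_nonneg(2)) auto
  finally show "- half_cauchy.expectation (\<lambda>t. ln (1 + t\<^sup>2)) \<le> half_cauchy.expectation (\<lambda>t. ln (D (t\<^sup>2)))"
    using Qq(2) by simp
qed

lemma (in prob_space) expectation_ln_le_ln_expectation:
  fixes X :: "'a \<Rightarrow> real"
  assumes "integrable M X" "integrable M (\<lambda>x. ln (X x))" "AE x in M. 0 < X x"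
  shows "expectation (\<lambda>x. ln (X x)) \<le> ln (expectation X)"
proof -
  have "convex_on {0<..} (\<lambda>x::real. - ln x)"
    using ln_concave by (simp add: concave_on_def)
  then have "- ln (expectation X) \<le> expectation (\<lambda>x. - ln (X x))"
    using assms by (intro jensens_inequality[of X "{0<..}"]) auto
  then show ?thesis by simp
qed

text \<open>
  The substitution \<open>u = t\<^sup>2\<close> in \<open>\<integral> g w du \<le> \<integral> g dM\<close>; the factor \<open>\<pi> t (1+t\<^sup>2)\<close> is the derivative
  \<open>2t\<close> divided by the half-Cauchy density.
\<close>

lemma half_cauchy_square_density_bound:
  fixes g w :: "real \<Rightarrow> real"
  assumes M: "sets M = sets borel" "density lborel (\<lambda>x. ennreal (w x)) \<le> M"
    and [measurable]: "w \<in> borel_measurable borel" and w: "\<And>x. w x \<ge> 0"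
    and g: "integrable M g" "\<And>x. g x \<ge> 0"
  defines "F \<equiv> \<lambda>t. g (t\<^sup>2) * (w (t\<^sup>2) * (pi * t * (1 + t\<^sup>2)))"
  shows "integrable half_cauchy F" and "half_cauchy.expectation F \<le> integral\<^sup>L M g"
proof -
  have [measurable]: "g \<in> borel_measurable borel"
    using borel_measurable_integrable[OF g(1)] unfolding measurable_cong_sets[OF M(1) refl] .
  let ?L = "density lborel (\<lambda>x. ennreal (w x))"
  have le: "(\<integral>\<^sup>+x. ennreal (g x) \<partial>?L) \<le> (\<integral>\<^sup>+x. ennreal (g x) \<partial>M)"
    by (rule nn_integral_mono_measure) (auto simp: M)
  have fin: "(\<integral>\<^sup>+x. ennreal (g x) \<partial>M) = ennreal (integral\<^sup>L M g)"
    using g by (intro nn_integral_eq_integral) auto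
  have "integrable ?L g"
    using le fin g(2) by (intro integrableI_bounded) (auto simp: top_unique less_top[symmetric])
  moreover from this have "integral\<^sup>L ?L g \<le> integral\<^sup>L M g"
    using le fin g(2) nn_integral_eq_integral[of ?L g] by simp
  ultimately have h: "integrable lborel (\<lambda>u. w u * g u)" "integral\<^sup>L lborel (\<lambda>u. w u * g u) \<le> integral\<^sup>L M g"
    using integrable_density[of g lborel w] integral_density[of g lborel w] w by auto
  let ?h = "\<lambda>u. w u * g u"
  have hs: "set_integrable lborel {0<..} ?h"
    unfolding set_integrable_def using h(1) by (rule integrable_mult_indicator[rotated]) simp
  have hi: "?h absolutely_integrable_on {0<..}" "integral {0<..} ?h = (LINT u:{0<..}|lborel. ?h u)"
    using absolutely_integrable_on_borel[of ?h "{0<..}"] hs by auto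
  have im: "(\<lambda>t::real. t\<^sup>2) ` {0<..} = {0<..}"
  proof safe
    fix x :: real assume "x > 0"
    then show "x \<in> (\<lambda>t. t\<^sup>2) ` {0<..}" by (intro image_eqI[of _ _ "sqrt x"]) auto
  qed auto
  have inj: "inj_on (\<lambda>t::real. t\<^sup>2) {0<..}"
    by (auto simp: inj_on_def power2_eq_iff)
  let ?k = "\<lambda>t. \<bar>2 * t\<bar> * ?h (t\<^sup>2)"
  have "?k absolutely_integrable_on {0<..} \<and> integral {0<..} ?k = integral {0<..} ?h"
    by (subst has_absolute_integral_change_of_variables_1'[OF _ _ inj])
      (auto simp: im hi intro!: derivative_eq_intros)
  moreover have "?k \<in> borel_measurable borel" by measurable
  ultimately have k: "set_integrable lborel {0<..} ?k"
    "(LINT t:{0<..}|lborel. ?k t) = (LINT u:{0<..}|lborel. ?h u)"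
    using absolutely_integrable_on_borel[of ?k "{0<..}"] hi(2) by auto
  have eq: "F t / (1 + t\<^sup>2) = pi / 2 * ?k t" if "t \<in> {0<..}" for t
  proof -
    have "1 + t\<^sup>2 > 0" by (simp add: add_pos_nonneg)
    then show ?thesis using that by (simp add: F_def divide_simps)
  qed
  have mF: "F \<in> borel_measurable borel" unfolding F_def by measurable
  show "integrable half_cauchy F"
    unfolding integrable_half_cauchy_iff(1)[OF mF]
    using set_integrable_mult_right[of "pi / 2", OF k(1)]
    by (subst set_integrable_cong[OF refl refl eq]) auto
  have "half_cauchy.expectation F = 2 / pi * (LINT t:{0<..}|lborel. pi / 2 * ?k t)"
    unfolding integrable_half_cauchy_iff(2)[OF mF]
    by (intro arg_cong[of _ _ "\<lambda>x. 2 / pi * x"] set_lebesgue_integral_cong) (use eq in auto)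
  also have "\<dots> = (LINT u:{0<..}|lborel. ?h u)"
    unfolding set_integral_mult_right k(2) by simp
  also have "\<dots> \<le> integral\<^sup>L lborel ?h"
    unfolding set_lebesgue_integral_def
    by (rule integral_mono) (use hs h(1) w g(2) in \<open>auto simp: set_integrable_def indicator_def\<close>)
  also note h(2)
  finally show "half_cauchy.expectation F \<le> integral\<^sup>L M g" .
qed

text \<open>
  Jensen's inequality for the logarithm, applied to \<open>min(1,\<bar>f-r\<bar>) W\<close> and to \<open>max(1,\<bar>f-r\<bar>) W\<close> where
  \<open>W\<close> is the function \<open>w\<close> transported to the variable \<open>t\<close>, bounds \<open>E ln \<bar>f-r\<bar> + 2 E ln W\<close> above by
  the logarithm of the product of the two integrals. The product form, rather than a bound for
  \<open>\<integral> \<bar>f-r\<bar> dM\<close> alone, is what keeps \<open>\<integral> min(1,\<bar>f-r\<bar>) dM\<close> away from zero when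
  \<open>\<integral> \<bar>f-r\<bar> dM\<close> is bounded.
\<close>

lemma log_integrable_density_separates:
  fixes w :: "real \<Rightarrow> real"
  assumes M: "finite_measure M" "sets M = sets borel" "density lborel (\<lambda>x. ennreal (w x)) \<le> M"
    and [measurable]: "w \<in> borel_measurable borel" and w: "\<And>x. w x \<ge> 0"
    and w_pos: "AE t in half_cauchy. w (t\<^sup>2) > 0"
    and w_ln: "integrable half_cauchy (\<lambda>t. ln (w (t\<^sup>2)))"
  obtains c where "c > 0"
    "\<And>p N. integrable M (\<lambda>u. 1 / (1 + u) - poly p u / u ^ N) \<Longrightarrow>
      c \<le> (LINT u|M. min 1 \<bar>1 / (1 + u) - poly p u / u ^ N\<bar>) * (LINT u|M. max 1 \<bar>1 / (1 + u) - poly p u / u ^ N\<bar>)"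
proof -
  interpret M: finite_measure M by (rule M(1))
  define W where "W t = w (t\<^sup>2) * (pi * t * (1 + t\<^sup>2))" for t
  have [measurable]: "W \<in> borel_measurable borel" unfolding W_def by measurable
  have W_pos: "AE t in half_cauchy. W t > 0"
    using w_pos AE_half_cauchy_pos by eventually_elim (auto simp: W_def add_pos_nonneg)
  have W_ln: "integrable half_cauchy (\<lambda>t. ln (W t))"
  proof (rule integrable_cong_AE_imp)
    show "integrable half_cauchy (\<lambda>t. ln (w (t\<^sup>2)) + (ln pi + (1 / 2 * ln \<bar>t\<^sup>2 - 0\<bar> + ln (1 + t\<^sup>2))))"
      by (intro Bochner_Integration.integrable_add integrable_mult_right w_ln
          half_cauchy_ln_square_minus_nonneg(1) half_cauchy_ln_one_plus_square) auto
    show "AE t in half_cauchy. ln (w (t\<^sup>2)) + (ln pi + (1 / 2 * ln \<bar>t\<^sup>2 - 0\<bar> + ln (1 + t\<^sup>2))) = ln (W t)"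
      using w_pos AE_half_cauchy_pos
    proof eventually_elim
      case (elim t)
      moreover have "1 + t\<^sup>2 > 0" by (simp add: add_pos_nonneg)
      ultimately show ?case by (simp add: W_def ln_mult_pos ln_realpow)
    qed
  qed measurable
  \<comment> \<open>By the bound for \<open>E ln \<bar>f-r\<bar>\<close> and twice Jensen, \<open>K\<close> is below the logarithm of the product of the integrals.\<close>
  define K where "K = 2 * half_cauchy.expectation (\<lambda>t. ln (W t)) - half_cauchy.expectation (\<lambda>t. ln (1 + t\<^sup>2))"
  show thesis
  proof (rule that[of "exp K"])
    fix p :: "real poly" and N :: nat
    define D where "D u = \<bar>1 / (1 + u) - poly p u / u ^ N\<bar>" for u :: real
    assume int: "integrable M (\<lambda>u. 1 / (1 + u) - poly p u / u ^ N)"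
    note D = half_cauchy_ln_resolvent_minus_rational[of p N, folded D_def]
    have D_int: "integrable M D" unfolding D_def using int by (rule integrable_abs)
    then have [measurable]: "D \<in> borel_measurable borel"
      using borel_measurable_integrable measurable_cong_sets[OF M(2) refl] by blast
    have step: "half_cauchy.expectation (\<lambda>t. ln (g (t\<^sup>2))) + half_cauchy.expectation (\<lambda>t. ln (W t)) \<le> ln (integral\<^sup>L M g)"
      and step_pos: "integral\<^sup>L M g > 0"
      if g: "integrable M g" "\<And>x. g x \<ge> 0" "\<And>u. D u > 0 \<Longrightarrow> g u > 0"
        and g_ln: "integrable half_cauchy (\<lambda>t. ln (g (t\<^sup>2)))" for g
    proof -
      note F = half_cauchy_square_density_bound[OF M(2,3) \<open>w \<in> borel_measurable borel\<close> w g(1,2), folded W_def]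
      have pos: "AE t in half_cauchy. g (t\<^sup>2) > 0" using D(3) by eventually_elim (rule g(3))
      have F_pos: "AE t in half_cauchy. g (t\<^sup>2) * W t > 0"
        using pos W_pos by eventually_elim simp
      have gm: "g \<in> borel_measurable borel"
        using borel_measurable_integrable[OF g(1)] measurable_cong_sets[OF M(2) refl] by blast
      note gm[measurable]
      have eq: "AE t in half_cauchy. ln (g (t\<^sup>2)) + ln (W t) = ln (g (t\<^sup>2) * W t)"
        using pos W_pos by eventually_elim (simp add: ln_mult_pos)
      have sum: "integrable half_cauchy (\<lambda>t. ln (g (t\<^sup>2)) + ln (W t))"
        using g_ln W_ln by (rule Bochner_Integration.integrable_add)
      have lnF: "integrable half_cauchy (\<lambda>t. ln (g (t\<^sup>2) * W t))"
        by (rule integrable_cong_AE_imp[OF sum]) (measurable, use eq in auto)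
      have F0: "half_cauchy.expectation (\<lambda>t. g (t\<^sup>2) * W t) > 0"
      proof -
        have "half_cauchy.expectation (\<lambda>t. g (t\<^sup>2) * W t) \<noteq> 0"
        proof
          assume "half_cauchy.expectation (\<lambda>t. g (t\<^sup>2) * W t) = 0"
          then have "AE t in half_cauchy. g (t\<^sup>2) * W t = 0"
            using F_pos by (subst (asm) integral_nonneg_eq_0_iff_AE[OF F(1)]) auto
          with F_pos have "AE t in half_cauchy. False" by eventually_elim simp
          then show False by (simp add: half_cauchy.AE_False)
        qed
        moreover have "half_cauchy.expectation (\<lambda>t. g (t\<^sup>2) * W t) \<ge> 0"
          by (rule integral_nonneg_AE) (use F_pos in auto)
        ultimately show ?thesis by simp
      qed
      show "integral\<^sup>L M g > 0" using F0 F(2) by simp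
      have "half_cauchy.expectation (\<lambda>t. ln (g (t\<^sup>2))) + half_cauchy.expectation (\<lambda>t. ln (W t))
          = half_cauchy.expectation (\<lambda>t. ln (g (t\<^sup>2)) + ln (W t))"
        using g_ln W_ln by simp
      also have "\<dots> = half_cauchy.expectation (\<lambda>t. ln (g (t\<^sup>2) * W t))"
        using eq by (intro integral_cong_AE) auto
      also have "\<dots> \<le> ln (half_cauchy.expectation (\<lambda>t. g (t\<^sup>2) * W t))"
        by (rule half_cauchy.expectation_ln_le_ln_expectation[OF F(1) lnF F_pos])
      also have "\<dots> \<le> ln (integral\<^sup>L M g)"
        using F0 F(2) by (intro ln_mono) auto
      finally show "half_cauchy.expectation (\<lambda>t. ln (g (t\<^sup>2))) + half_cauchy.expectation (\<lambda>t. ln (W t)) \<le> ln (integral\<^sup>L M g)" .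
    qed
    have D0: "D u \<ge> 0" for u by (simp add: D_def)
    let ?m = "\<lambda>u. min 1 (D u)" and ?X = "\<lambda>u. max 1 (D u)"
    have ints: "integrable M ?m" "integrable M ?X"
      using D_int by auto
    have bnd: "\<bar>ln (?m u)\<bar> \<le> \<bar>ln (D u)\<bar>" "\<bar>ln (?X u)\<bar> \<le> \<bar>ln (D u)\<bar>" for u
      by (auto simp: min_def max_def)
    have lnm: "integrable half_cauchy (\<lambda>t. ln (?m (t\<^sup>2)))" and lnX: "integrable half_cauchy (\<lambda>t. ln (?X (t\<^sup>2)))"
      by (rule Bochner_Integration.integrable_bound[OF D(1)]; measurable; use bnd in simp)+
    have "ln (D u) = ln (?m u) + ln (?X u)" for u
      by (auto simp: min_def max_def)
    then have "half_cauchy.expectation (\<lambda>t. ln (D (t\<^sup>2)))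
        = half_cauchy.expectation (\<lambda>t. ln (?m (t\<^sup>2))) + half_cauchy.expectation (\<lambda>t. ln (?X (t\<^sup>2)))"
      using lnm lnX by (simp only: Bochner_Integration.integral_add)
    then have "K \<le> ln (integral\<^sup>L M ?m) + ln (integral\<^sup>L M ?X)"
      using D(2) step[OF ints(1) _ _ lnm] step[OF ints(2) _ _ lnX] D0 unfolding K_def
      by (simp add: le_max_iff_disj less_max_iff_disj)
    also have "\<dots> = ln (integral\<^sup>L M ?m * integral\<^sup>L M ?X)"
      using step_pos[OF ints(1) _ _ lnm] step_pos[OF ints(2) _ _ lnX] D0
      by (intro ln_mult_pos[symmetric]) (simp_all add: le_max_iff_disj less_max_iff_disj)
    finally have "exp K \<le> exp (ln (integral\<^sup>L M ?m * integral\<^sup>L M ?X))" by simp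
    also have "\<dots> = integral\<^sup>L M ?m * integral\<^sup>L M ?X"
      using step_pos[OF ints(1) _ _ lnm] step_pos[OF ints(2) _ _ lnX] D0
      by (intro exp_ln mult_pos_pos) (simp_all add: le_max_iff_disj less_max_iff_disj)
    finally show "exp K \<le> (LINT u|M. min 1 \<bar>1 / (1 + u) - poly p u / u ^ N\<bar>) * (LINT u|M. max 1 \<bar>1 / (1 + u) - poly p u / u ^ N\<bar>)"
      unfolding D_def .
  qed simp
qed

section \<open>A bounded annihilator by minimising the Huber functional\<close>

definition clip :: "real \<Rightarrow> real" where "clip x = max (- 1) (min 1 x)"

text \<open>
  The convex function with derivative \<open>clip\<close>: it equals \<open>x\<^sup>2/2\<close> for \<open>\<bar>x\<bar> \<le> 1\<close> and
  \<open>\<bar>x\<bar> - 1/2\<close> otherwise. The formula is the value at the maximiser \<open>a = clip x\<close> of \<open>a x - a\<^sup>2/2\<close> over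
  \<open>\<bar>a\<bar> \<le> 1\<close>, which makes the tangent inequalities purely algebraic.
\<close>

definition huber :: "real \<Rightarrow> real" where "huber x = x * clip x - (clip x)\<^sup>2 / 2"

lemma abs_clip: "\<bar>clip x\<bar> = min 1 \<bar>x\<bar>" "\<bar>clip x\<bar> \<le> 1"
  by (auto simp: clip_def)

lemma borel_measurable_clip [measurable]: "clip \<in> borel_measurable borel"
  unfolding clip_def by measurable

lemma borel_measurable_huber [measurable]: "huber \<in> borel_measurable borel"
  unfolding huber_def by measurable

lemma huber_cases:
  obtains "x \<le> - 1" "clip x = - 1" "huber x = - x - 1 / 2"
  | "- 1 \<le> x" "x \<le> 1" "clip x = x" "huber x = x\<^sup>2 / 2"
  | "1 \<le> x" "clip x = 1" "huber x = x - 1 / 2"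
  by (cases "x \<le> - 1"; cases "x \<le> 1") (auto simp: clip_def huber_def power2_eq_square)

lemma huber_bounds: "0 \<le> huber x" "huber x \<le> \<bar>x\<bar>" "\<bar>x\<bar> - 1 / 2 \<le> huber x"
proof -
  have "\<bar>x\<bar> - 1 / 2 \<le> x\<^sup>2 / 2"
  proof -
    have "0 \<le> (\<bar>x\<bar> - 1)\<^sup>2" by simp
    then show ?thesis by (simp add: power2_diff)
  qed
  moreover have "x\<^sup>2 / 2 \<le> \<bar>x\<bar>" if "\<bar>x\<bar> \<le> 1"
  proof -
    have "\<bar>x\<bar> * \<bar>x\<bar> \<le> \<bar>x\<bar>" by (rule mult_left_le[OF that]) simp
    then show ?thesis by (simp add: power2_eq_square)
  qed
  moreover have "0 \<le> x\<^sup>2 / 2" by simp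
  ultimately have "0 \<le> huber x \<and> huber x \<le> \<bar>x\<bar> \<and> \<bar>x\<bar> - 1 / 2 \<le> huber x"
    by - (rule huber_cases[of x]; simp only:; linarith)
  then show "0 \<le> huber x" "huber x \<le> \<bar>x\<bar>" "\<bar>x\<bar> - 1 / 2 \<le> huber x"
    by auto
qed

text \<open>
  The variational characterisation of the projection onto the convex set \<open>[-1,1]\<close>.
\<close>

lemma clip_variational: "\<bar>a\<bar> \<le> 1 \<Longrightarrow> 0 \<le> (clip x - a) * (x - clip x)"
  by (rule huber_cases[of x]) (auto intro: mult_nonneg_nonneg mult_nonpos_nonpos)

text \<open>
  Convexity, strengthened by the square of the change of the derivative.
\<close>

lemma huber_lower_tangent: "huber x + clip x * d + (clip (x + d) - clip x)\<^sup>2 / 2 \<le> huber (x + d)"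
  using clip_variational[OF abs_clip(2)[of x], of "x + d"]
  by (simp add: huber_def power2_eq_square field_simps)

lemma huber_upper_tangent: "huber (x + d) \<le> huber x + clip x * d + d\<^sup>2 / 2"
proof -
  have "0 \<le> (clip (x + d) - clip x - d)\<^sup>2 / 2" by simp
  then show ?thesis
    using clip_variational[OF abs_clip(2)[of "x + d"], of x]
    by (simp add: huber_def power2_eq_square field_simps)
qed

text \<open>
  Two near-minimisers of a Huber functional may be far apart, but this forces their derivatives to be
  close.
\<close>

lemma huber_midpoint:
  "(clip x - clip y)\<^sup>2 / 4 \<le> huber x + huber y - 2 * huber ((x + y) / 2)"
proof -
  let ?z = "(x + y) / 2"
  have "huber ?z + clip ?z * ((x - y) / 2) + (clip x - clip ?z)\<^sup>2 / 2 \<le> huber x"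
    using huber_lower_tangent[of ?z "(x - y) / 2"] by (simp add: field_simps)
  moreover have "huber ?z + clip ?z * ((y - x) / 2) + (clip y - clip ?z)\<^sup>2 / 2 \<le> huber y"
    using huber_lower_tangent[of ?z "(y - x) / 2"] by (simp add: field_simps)
  moreover have "(clip x - clip y)\<^sup>2 / 4 \<le> (clip x - clip ?z)\<^sup>2 / 2 + (clip y - clip ?z)\<^sup>2 / 2"
  proof -
    have "(a - b)\<^sup>2 / 4 \<le> (a - z)\<^sup>2 / 2 + (b - z)\<^sup>2 / 2" for a b z :: real
    proof -
      have "(a - z)\<^sup>2 / 2 + (b - z)\<^sup>2 / 2 - (a - b)\<^sup>2 / 4 = (a + b - 2 * z)\<^sup>2 / 4"
        by (simp add: power2_eq_square field_simps)
      then show ?thesis by (smt (verit) zero_le_power2 divide_nonneg_pos)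
    qed
    then show ?thesis .
  qed
  moreover have "clip ?z * ((x - y) / 2) + clip ?z * ((y - x) / 2) = 0"
    by (simp add: diff_divide_distrib algebra_simps)
  ultimately show ?thesis by linarith
qed

text \<open>
  For a minimising sequence \<open>r\<^sub>k\<close> of \<open>J(r) = \<integral> huber (f-r)\<close>, the midpoint inequality makes
  \<open>clip (f-r\<^sub>k)\<close> a Cauchy sequence in \<open>L\<^sup>2\<close>. Choosing \<open>J(r\<^sub>k)\<close> within \<open>1/4\<^sup>k\<close> of the infimum makes it
  converge almost everywhere. The limit annihilates \<open>V\<close> because \<open>J(r\<^sub>k + s v)\<close> cannot fall
  below the infimum, and it is nonzero because
  \<open>\<integral> max(1,\<bar>f-r\<^sub>k\<bar>)\<close> is bounded by \<open>J(r\<^sub>k)\<close> up to a constant.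
\<close>

lemma (in finite_measure) exists_bounded_annihilator:
  fixes f :: "'a \<Rightarrow> real" and V :: "('a \<Rightarrow> real) set"
  assumes f: "integrable M f"
    and V0: "(\<lambda>_. 0) \<in> V"
    and lin: "\<And>a b r s. r \<in> V \<Longrightarrow> s \<in> V \<Longrightarrow> (\<lambda>x. a * r x + b * s x) \<in> V"
    and int1: "\<And>r. r \<in> V \<Longrightarrow> integrable M r"
    and int2: "\<And>r. r \<in> V \<Longrightarrow> integrable M (\<lambda>x. (r x)\<^sup>2)"
    and c: "c > 0"
    and sep: "\<And>r. r \<in> V \<Longrightarrow> c \<le> (LINT x|M. min 1 \<bar>f x - r x\<bar>) * (LINT x|M. max 1 \<bar>f x - r x\<bar>)"
  obtains \<phi> where "\<phi> \<in> borel_measurable M" "\<And>x. \<bar>\<phi> x\<bar> \<le> 1"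
    "\<And>r. r \<in> V \<Longrightarrow> (LINT x|M. \<phi> x * r x) = 0" "\<not> (AE x in M. \<phi> x = 0)"
proof -
  have [measurable]: "f \<in> borel_measurable M" using f by auto
  have Vm: "r \<in> borel_measurable M" if "r \<in> V" for r using int1[OF that] by auto
  define J where "J r = (LINT x|M. huber (f x - r x))" for r
  have Jint: "integrable M (\<lambda>x. huber (f x - r x))" if r: "r \<in> V" for r
  proof (rule Bochner_Integration.integrable_bound)
    show "integrable M (\<lambda>x. f x - r x)" using f int1[OF r] by (rule Bochner_Integration.integrable_diff)
    show "(\<lambda>x. huber (f x - r x)) \<in> borel_measurable M" using Vm[OF r] by measurable
    show "AE x in M. norm (huber (f x - r x)) \<le> norm (f x - r x)"
      using huber_bounds by (auto simp: abs_of_nonneg)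
  qed
  define I where "I = Inf (J ` V)"
  have bdd: "bdd_below (J ` V)"
    unfolding J_def by (intro bdd_belowI2[of _ 0] integral_nonneg_AE) (simp add: huber_bounds)
  have I_le: "I \<le> J r" if "r \<in> V" for r
    unfolding I_def using bdd that by (intro cInf_lower) auto
  have "\<exists>r\<in>V. J r < I + e" if "e > 0" for e
    using cInf_lessD[of "J ` V" "I + e"] V0 that by (auto simp: I_def)
  then have "\<forall>k::nat. \<exists>r\<in>V. J r < I + (1 / 4) ^ k" by simp
  then obtain r where r: "\<And>k. r k \<in> V" "\<And>k. J (r k) < I + (1 / 4) ^ k"
    by metis
  have [measurable]: "r k \<in> borel_measurable M" for k using r(1) Vm by auto
  define \<phi> where "\<phi> k x = clip (f x - r k x)" for k :: nat and x
  have [measurable]: "\<phi> k \<in> borel_measurable M" for k unfolding \<phi>_def by measurable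
  have \<phi>1: "\<bar>\<phi> k x\<bar> \<le> 1" for k x by (simp add: \<phi>_def abs_clip)
  have \<phi>int: "integrable M (\<phi> k)" for k
    by (rule integrable_const_bound[of _ 1]) (auto simp: \<phi>1)
  define d where "d k x = \<phi> (Suc k) x - \<phi> k x" for k x
  have [measurable]: "d k \<in> borel_measurable M" for k unfolding d_def by measurable
  have dint: "integrable M (d k)" "integrable M (\<lambda>x. (d k x)\<^sup>2)" for k
  proof -
    show "integrable M (d k)" unfolding d_def by (intro Bochner_Integration.integrable_diff \<phi>int)
    have "\<bar>d k x\<bar> \<le> 2" for x using \<phi>1[of k x] \<phi>1[of "Suc k" x] by (auto simp: d_def)
    then have "(d k x)\<^sup>2 \<le> 2\<^sup>2" for x by (metis abs_le_square_iff abs_numeral)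
    then show "integrable M (\<lambda>x. (d k x)\<^sup>2)"
      by (intro integrable_const_bound[of _ 4]) auto
  qed
  have d2: "(LINT x|M. (d k x)\<^sup>2) \<le> 8 * (1 / 4) ^ k" for k
  proof -
    define s where "s x = 1 / 2 * r k x + 1 / 2 * r (Suc k) x" for x
    have s: "s \<in> V" unfolding s_def by (rule lin) (rule r(1))+
    have mid: "((f x - r (Suc k) x) + (f x - r k x)) / 2 = f x - s x" for x
      by (simp add: s_def field_simps)
    have "(LINT x|M. (d k x)\<^sup>2 / 4) \<le>
        (LINT x|M. huber (f x - r (Suc k) x) + huber (f x - r k x) - 2 * huber (f x - s x))"
    proof (rule integral_mono)
      show "(d k x)\<^sup>2 / 4 \<le> huber (f x - r (Suc k) x) + huber (f x - r k x) - 2 * huber (f x - s x)" for x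
        using huber_midpoint[of "f x - r (Suc k) x" "f x - r k x"] unfolding mid by (simp add: d_def \<phi>_def)
    qed (use dint Jint r(1) s in auto)
    also have "\<dots> = J (r (Suc k)) + J (r k) - 2 * J s"
      unfolding J_def using Jint r(1) s by simp
    also have "\<dots> \<le> (1 / 4) ^ Suc k + (1 / 4) ^ k"
      using r(2)[of k] r(2)[of "Suc k"] I_le[OF s] by linarith
    also have "\<dots> \<le> 2 * (1 / 4) ^ k" by simp
    finally show ?thesis by simp
  qed
  have d1: "(LINT x|M. \<bar>d k x\<bar>) \<le> (measure M (space M) + 8) * (1 / 2) ^ k" for k
  proof -
    \<comment> \<open>An \<open>L\<^sup>1\<close> bound from the \<open>L\<^sup>2\<close> bound: the weight \<open>2\<^sup>k\<close> balances the two summands.\<close>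
    have "\<bar>y\<bar> \<le> (1 / 2) ^ k + 2 ^ k * y\<^sup>2" for y :: real
    proof (cases "\<bar>y\<bar> \<le> (1 / 2) ^ k")
      case False
      then have "(1 / 2) ^ k * \<bar>y\<bar> \<le> \<bar>y\<bar> * \<bar>y\<bar>" by (intro mult_right_mono) auto
      then have "\<bar>y\<bar> \<le> 2 ^ k * y\<^sup>2" by (simp add: field_simps power2_eq_square)
      then show ?thesis by (simp add: add_increasing)
    qed (simp add: add_increasing2)
    then have "(LINT x|M. \<bar>d k x\<bar>) \<le> (LINT x|M. (1 / 2) ^ k + 2 ^ k * (d k x)\<^sup>2)"
      using dint by (intro integral_mono) auto
    also have "\<dots> = measure M (space M) * (1 / 2) ^ k + 2 ^ k * (LINT x|M. (d k x)\<^sup>2)"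
      using dint by simp
    also have "\<dots> \<le> measure M (space M) * (1 / 2) ^ k + 2 ^ k * (8 * (1 / 4) ^ k)"
      using d2 by (intro add_mono mult_left_mono) auto
    also have "\<dots> = (measure M (space M) + 8) * (1 / 2) ^ k"
    proof -
      have "(2 :: real) ^ k * (1 / 4) ^ k = (1 / 2) ^ k" by (simp flip: power_mult_distrib)
      then show ?thesis by (simp add: algebra_simps)
    qed
    finally show ?thesis .
  qed
  have AE_conv: "AE x in M. convergent (\<lambda>k. \<phi> k x)"
  proof -
    have "(\<integral>\<^sup>+x. (\<Sum>k. ennreal \<bar>d k x\<bar>) \<partial>M) = (\<Sum>k. \<integral>\<^sup>+x. ennreal \<bar>d k x\<bar> \<partial>M)"
      by (rule nn_integral_suminf) measurable
    also have "\<dots> = (\<Sum>k. ennreal (LINT x|M. \<bar>d k x\<bar>))"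
      using dint by (intro arg_cong[of _ _ suminf] ext nn_integral_eq_integral) auto
    also have "\<dots> \<noteq> \<infinity>"
    proof -
      have "summable (\<lambda>k. (measure M (space M) + 8) * (1 / 2) ^ k)"
        by (intro summable_mult summable_geometric) auto
      then have "summable (\<lambda>k. LINT x|M. \<bar>d k x\<bar>)"
        by (rule summable_comparison_test[rotated]) (use d1 in \<open>auto intro!: exI[of _ 0]\<close>)
      then show ?thesis by (subst suminf_ennreal2) auto
    qed
    finally have "AE x in M. (\<Sum>k. ennreal \<bar>d k x\<bar>) \<noteq> \<infinity>"
      by (intro nn_integral_PInf_AE) measurable
    then show ?thesis
    proof eventually_elim
      case (elim x)
      then have "summable (\<lambda>k. \<bar>d k x\<bar>)" by (intro summable_suminf_not_top) auto
      then have "summable (\<lambda>k. d k x)" by (rule summable_rabs_cancel)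
      then have "convergent (\<lambda>n. \<Sum>k<n. d k x)" by (simp add: summable_iff_convergent)
      moreover have "(\<Sum>k<n. d k x) = \<phi> n x - \<phi> 0 x" for n
        unfolding d_def by (rule sum_lessThan_telescope)
      ultimately have "convergent (\<lambda>n. \<phi> n x - \<phi> 0 x)" by simp
      then have "convergent (\<lambda>n. (\<phi> n x - \<phi> 0 x) + \<phi> 0 x)" by (intro convergent_add convergent_const)
      then show ?case by simp
    qed
  qed
  \<comment> \<open>Clipping bounds the function also where the sequence diverges and \<open>lim\<close> is arbitrary.\<close>
  define \<psi> where "\<psi> x = clip (lim (\<lambda>k. \<phi> k x))" for x
  have [measurable]: "\<psi> \<in> borel_measurable M" unfolding \<psi>_def by measurable
  have \<psi>1: "\<bar>\<psi> x\<bar> \<le> 1" for x by (simp add: \<psi>_def abs_clip)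
  have lim: "AE x in M. (\<lambda>k. \<phi> k x) \<longlonglongrightarrow> \<psi> x"
    using AE_conv
  proof eventually_elim
    case (elim x)
    then have L: "(\<lambda>k. \<phi> k x) \<longlonglongrightarrow> lim (\<lambda>k. \<phi> k x)" by (simp add: convergent_LIMSEQ_iff)
    then have "\<bar>lim (\<lambda>k. \<phi> k x)\<bar> \<le> 1"
      by (rule tendsto_upperbound[OF tendsto_rabs]) (auto simp: \<phi>1)
    then have "\<psi> x = lim (\<lambda>k. \<phi> k x)" by (auto simp: \<psi>_def clip_def)
    with L show ?case by simp
  qed
  show thesis
  proof (rule that[of \<psi>])
    fix v assume v: "v \<in> V"
    note [measurable] = Vm[OF v]
    define A B where "A = (LINT x|M. (v x)\<^sup>2)" and "B = (LINT x|M. \<psi> x * v x)"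
    have A: "A \<ge> 0" unfolding A_def by simp
    have \<phi>v: "integrable M (\<lambda>x. \<phi> k x * v x)" for k
      by (rule Bochner_Integration.integrable_bound[OF int1[OF v]]) (auto simp: abs_mult \<phi>1 intro!: mult_left_le_one_le)
    have lim_B: "(\<lambda>k. LINT x|M. \<phi> k x * v x) \<longlonglongrightarrow> B"
      unfolding B_def
    proof (rule integral_dominated_convergence)
      show "integrable M (\<lambda>x. \<bar>v x\<bar>)" using int1[OF v] by simp
      show "AE x in M. (\<lambda>k. \<phi> k x * v x) \<longlonglongrightarrow> \<psi> x * v x"
        using lim by eventually_elim (intro tendsto_intros)
      show "AE x in M. norm (\<phi> k x * v x) \<le> \<bar>v x\<bar>" for k
        by (auto simp: abs_mult \<phi>1 intro!: mult_left_le_one_le)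
    qed measurable
    \<comment> \<open>A linear function of \<open>s\<close> below a quadratic one with a double zero at the origin must vanish.\<close>
    have *: "s * B \<le> s\<^sup>2 / 2 * A" for s
    proof -
      have "s * (LINT x|M. \<phi> k x * v x) \<le> (1 / 4) ^ k + s\<^sup>2 / 2 * A" for k
      proof -
        define u where "u x = 1 * r k x + s * v x" for x
        have u: "u \<in> V" unfolding u_def by (rule lin[OF r(1) v])
        have "J u \<le> (LINT x|M. huber (f x - r k x) - s * (\<phi> k x * v x) + s\<^sup>2 / 2 * (v x)\<^sup>2)"
          unfolding J_def
        proof (rule integral_mono)
          show "huber (f x - u x) \<le> huber (f x - r k x) - s * (\<phi> k x * v x) + s\<^sup>2 / 2 * (v x)\<^sup>2" for x
            using huber_upper_tangent[of "f x - r k x" "- (s * v x)"]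
            by (simp add: u_def \<phi>_def power_mult_distrib algebra_simps)
        qed (use Jint[OF u] Jint[OF r(1)] \<phi>v int2[OF v] in auto)
        also have "\<dots> = J (r k) - s * (LINT x|M. \<phi> k x * v x) + s\<^sup>2 / 2 * A"
          unfolding J_def A_def using Jint[OF r(1)] \<phi>v int2[OF v] by simp
        finally show ?thesis using I_le[OF u] r(2)[of k] by linarith
      qed
      moreover have "(\<lambda>k. s * (LINT x|M. \<phi> k x * v x)) \<longlonglongrightarrow> s * B"
        by (intro tendsto_intros lim_B)
      moreover have "(\<lambda>k. (1 / 4) ^ k + s\<^sup>2 / 2 * A) \<longlonglongrightarrow> 0 + s\<^sup>2 / 2 * A"
        by (intro tendsto_intros LIMSEQ_power_zero) auto
      ultimately have "s * B \<le> 0 + s\<^sup>2 / 2 * A" by (intro LIMSEQ_le) auto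
      then show ?thesis by simp
    qed
    have "B / P * B = B\<^sup>2 / P" "(B / P)\<^sup>2 / 2 * A = B\<^sup>2 / P * (A / (2 * P))" for P
      by (simp_all add: power2_eq_square)
    with *[of "B / (A + 1)"] have "B\<^sup>2 / (A + 1) \<le> B\<^sup>2 / (A + 1) * (A / (2 * (A + 1)))"
      by (simp only:)
    moreover have "A / (2 * (A + 1)) \<le> 1 / 2" using A by (simp add: field_simps)
    then have "B\<^sup>2 / (A + 1) * (A / (2 * (A + 1))) \<le> B\<^sup>2 / (A + 1) * (1 / 2)"
      using A by (intro mult_left_mono) auto
    ultimately have "B\<^sup>2 / (A + 1) \<le> B\<^sup>2 / (A + 1) * (1 / 2)" by (rule order.trans)
    then have "B\<^sup>2 / (A + 1) \<le> 0"
    proof -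
      have "y \<le> y * (1 / 2) \<Longrightarrow> y \<le> 0" for y :: real by simp
      then show ?thesis using \<open>B\<^sup>2 / (A + 1) \<le> B\<^sup>2 / (A + 1) * (1 / 2)\<close> .
    qed
    then have "B\<^sup>2 \<le> 0" using A by (simp add: divide_le_0_iff)
    then show "(LINT x|M. \<psi> x * v x) = 0" by (simp add: B_def)
  next
    define K where "K = 3 / 2 * measure M (space M) + (I + 1)"
    have low: "c / K \<le> (LINT x|M. \<bar>\<phi> k x\<bar>)" and K: "K > 0" for k
    proof -
      have fr: "integrable M (\<lambda>x. f x - r k x)"
        using f int1[OF r(1)] by (rule Bochner_Integration.integrable_diff)
      have "(LINT x|M. max 1 \<bar>f x - r k x\<bar>) \<le> (LINT x|M. 3 / 2 + huber (f x - r k x))"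
      proof (rule integral_mono)
        show "max 1 \<bar>f x - r k x\<bar> \<le> 3 / 2 + huber (f x - r k x)" for x
          using huber_bounds[of "f x - r k x"] by auto
      qed (use fr Jint[OF r(1)] in auto)
      also have "\<dots> = 3 / 2 * measure M (space M) + J (r k)"
        unfolding J_def using Jint[OF r(1)] by simp
      also have "\<dots> \<le> K"
      proof -
        have "(1 / 4 :: real) ^ k \<le> 1" by (rule power_le_one) auto
        with r(2)[of k] show ?thesis unfolding K_def by simp
      qed
      finally have X: "(LINT x|M. max 1 \<bar>f x - r k x\<bar>) \<le> K" .
      have "c \<le> (LINT x|M. \<bar>\<phi> k x\<bar>) * (LINT x|M. max 1 \<bar>f x - r k x\<bar>)"
        using sep[OF r(1), of k] by (simp add: \<phi>_def abs_clip)
      also have "\<dots> \<le> (LINT x|M. \<bar>\<phi> k x\<bar>) * K"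
        using X by (intro mult_left_mono) auto
      finally have cK: "c \<le> (LINT x|M. \<bar>\<phi> k x\<bar>) * K" .
      have "K \<ge> 0" using X order.trans[OF integral_nonneg_AE X] by auto
      with cK c show "K > 0" by (cases "K = 0") auto
      with cK show "c / K \<le> (LINT x|M. \<bar>\<phi> k x\<bar>)" by (simp add: pos_divide_le_eq)
    qed
    have "(\<lambda>k. LINT x|M. \<bar>\<phi> k x\<bar>) \<longlonglongrightarrow> (LINT x|M. \<bar>\<psi> x\<bar>)"
    proof (rule integral_dominated_convergence)
      show "integrable M (\<lambda>_. 1 :: real)" by simp
      show "AE x in M. (\<lambda>k. \<bar>\<phi> k x\<bar>) \<longlonglongrightarrow> \<bar>\<psi> x\<bar>"
        using lim by eventually_elim (intro tendsto_intros)
    qed (auto simp: \<phi>1)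
    then have "c / K \<le> (LINT x|M. \<bar>\<psi> x\<bar>)"
      by (rule LIMSEQ_le_const) (use low in auto)
    then have pos: "(LINT x|M. \<bar>\<psi> x\<bar>) > 0" using c K by (smt (verit) divide_pos_pos)
    show "\<not> (AE x in M. \<psi> x = 0)"
    proof
      assume "AE x in M. \<psi> x = 0"
      then have "(LINT x|M. \<bar>\<psi> x\<bar>) = (LINT x|M. 0)"
        by (intro integral_cong_AE) auto
      with pos show False by simp
    qed
  qed (use \<psi>1 in auto)
qed

section \<open>Stieltjes measures on the half-line\<close>

text \<open>
  A mass at the origin would make the moment of order \<open>-1\<close> infinite.
\<close>

lemma AE_stieltjes_measure_pos:
  assumes F: "distribution_function {0..} F" and mom: "finite_moments F"
  shows "AE x in stieltjes_measure F. 0 < x"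
proof -
  let ?M = "stieltjes_measure F" and ?R = "right_limit_extension F"
  have Ioc: "{a<..b} \<in> null_sets ?M" if "b < 0" for a b
  proof (cases "a \<le> b")
    case True
    have "emeasure ?M {a<..b} = ennreal (?R b - ?R a)"
      unfolding stieltjes_measure_def
      by (rule emeasure_interval_measure_Ioc[OF True])
        (use mono_right_limit_extension[OF F] right_cont_right_limit_extension[OF F] in auto)
    also have "\<dots> = 0" using True that by (simp add: right_limit_extension_def)
    finally show ?thesis by (intro null_setsI) auto
  qed auto
  have "(\<Union>n::nat. {- real n - 1<..- (1 / (real n + 1))}) \<in> null_sets ?M"
    by (intro null_sets_UN Ioc) auto
  moreover have "{..<0} \<subseteq> (\<Union>n::nat. {- real n - 1<..- (1 / (real n + 1))})"
  proof
    fix x :: real assume "x \<in> {..<0}"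
    then have x: "x < 0" by simp
    obtain n where n: "max (- x) (1 / (- x)) < real n" using reals_Archimedean2 by blast
    then have "1 / (- x) < real n + 1" by simp
    then have "x \<le> - (1 / (real n + 1))" using x by (simp add: field_simps)
    with n show "x \<in> (\<Union>n::nat. {- real n - 1<..- (1 / (real n + 1))})"
      by (intro UN_I[of n]) auto
  qed
  ultimately have neg: "{..<0} \<in> null_sets ?M" by (elim null_sets_subset) auto
  have "(\<integral>\<^sup>+x. \<infinity> * indicator {0} x \<partial>?M) \<le> ext_moment F (-1)"
    unfolding ext_moment_def
    by (rule nn_integral_mono) (auto simp: indicator_def power_int_def)
  also have "\<dots> < \<infinity>" using mom by (auto simp: finite_moments_def)
  finally have "\<infinity> * emeasure ?M {0} < \<infinity>" by (subst (asm) nn_integral_cmult_indicator) auto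
  then have zero: "{0} \<in> null_sets ?M"
    by (intro null_setsI) (auto simp: ennreal_top_mult split: if_splits)
  have "{..<0} \<union> {0} \<in> null_sets ?M" using neg zero by (rule null_sets.Un)
  then have "AE x in ?M. x \<notin> {..<0} \<union> {0}" by (rule AE_not_in)
  then show ?thesis by eventually_elim auto
qed

lemma stieltjes_measure_cdf:
  assumes N: "finite_borel_measure N" and pos: "AE x in N. 0 < x"
  shows "stieltjes_measure (cdf N) = N"
proof -
  interpret finite_borel_measure N by (rule N)
  have "cdf N x = 0" if "x \<le> 0" for x
  proof -
    have "AE y in N. y \<notin> {..x}" using pos by eventually_elim (use that in auto)
    then have "emeasure N {..x} = 0"
      by (subst AE_iff_measurable[symmetric, where P="\<lambda>y. y \<notin> {..x}"]) (auto simp: borel_UNIV M_is_borel)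
    then show ?thesis by (simp add: cdf_def measure_def)
  qed
  moreover have "Lim (at_right x) (cdf N) = cdf N x" for x
    using cdf_is_right_cont[of x] by (intro tendsto_Lim) (auto simp: continuous_within)
  ultimately have "right_limit_extension (cdf N) = cdf N"
    by (auto simp: right_limit_extension_def fun_eq_iff)
  then have "stieltjes_measure (cdf N) = interval_measure (cdf N)" by (simp add: stieltjes_measure_def)
  also have "\<dots> = N"
  proof (rule cdf_unique'[OF _ N])
    show "finite_borel_measure (interval_measure (cdf N))"
      using cdf_nondecreasing cdf_is_right_cont cdf_lim_at_bot cdf_lim_at_top
      by (intro finite_borel_measure_interval_measure) auto
    show "cdf (interval_measure (cdf N)) = cdf N"
      using cdf_nondecreasing cdf_is_right_cont cdf_lim_at_bot by (intro cdf_interval_measure) auto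
  qed
  finally show ?thesis .
qed

text \<open>
  The indicator of \<open>]-\<infinity>,b]\<close> is the bounded pointwise limit of piecewise linear functions whose
  restrictions to the half-line have compact support, so the two cumulative distribution functions
  agree.
\<close>

lemma distribution_eq_imp_stieltjes_measure_eq:
  assumes eq: "distribution_eq \<alpha> \<beta>"
    and fin: "finite_measure (stieltjes_measure \<alpha>)" "finite_measure (stieltjes_measure \<beta>)"
    and pos: "AE x in stieltjes_measure \<alpha>. 0 < x" "AE x in stieltjes_measure \<beta>. 0 < x"
  shows "stieltjes_measure \<alpha> = stieltjes_measure \<beta>"
proof (rule cdf_unique')
  show fb: "finite_borel_measure (stieltjes_measure \<alpha>)" "finite_borel_measure (stieltjes_measure \<beta>)"
    using fin by (auto simp: finite_borel_measure_def finite_borel_measure_axioms_def)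
  show "cdf (stieltjes_measure \<alpha>) = cdf (stieltjes_measure \<beta>)"
  proof
    fix b :: real
    define f where "f n x = max 0 (min 1 (1 - real n * (x - b)))" for n :: nat and x
    have f1: "\<bar>f n x\<bar> \<le> 1" for n x by (auto simp: f_def)
    have lim: "(\<lambda>n. f n x) \<longlonglongrightarrow> indicator {..b} x" for x
    proof (cases "x \<le> b")
      case True
      then have "real n * (x - b) \<le> 0" for n by (simp add: mult_nonneg_nonpos)
      then have "f n x = 1" for n unfolding f_def by (smt (verit))
      with True show ?thesis by simp
    next
      case False
      obtain n0 where n0: "1 / (x - b) < real n0" using reals_Archimedean2 by blast
      have "f n x = 0" if "n \<ge> n0" for n
      proof -
        have "1 / (x - b) \<le> real n" using n0 that by linarith
        then have "1 \<le> real n * (x - b)" using False by (simp add: field_simps)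
        then show ?thesis by (auto simp: f_def)
      qed
      then have "eventually (\<lambda>n. f n x = 0) sequentially" by (auto simp: eventually_sequentially)
      with False show ?thesis by (simp add: tendsto_eventually)
    qed
    have conv: "(\<lambda>n. LINT x:{0..}|stieltjes_measure \<gamma>. f n x) \<longlonglongrightarrow> cdf (stieltjes_measure \<gamma>) b"
      if "finite_measure (stieltjes_measure \<gamma>)" "AE x in stieltjes_measure \<gamma>. 0 < x" for \<gamma>
    proof -
      interpret finite_measure "stieltjes_measure \<gamma>" by fact
      have "(\<lambda>n. LINT x:{0..}|stieltjes_measure \<gamma>. f n x) \<longlonglongrightarrow> (LINT x|stieltjes_measure \<gamma>. indicator {..b} x)"
        unfolding set_lebesgue_integral_def
      proof (rule integral_dominated_convergence)
        show "integrable (stieltjes_measure \<gamma>) (\<lambda>_. 1 :: real)" by simp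
        show "AE x in stieltjes_measure \<gamma>. (\<lambda>n. indicator {0..} x *\<^sub>R f n x) \<longlonglongrightarrow> indicator {..b} x"
          using that(2) by eventually_elim (use lim in simp)
        show "AE x in stieltjes_measure \<gamma>. norm (indicator {0..} x *\<^sub>R f n x) \<le> 1" for n
          using f1 by (auto simp: indicator_def)
      qed (simp_all add: f_def)
      then show ?thesis by (simp add: cdf_def)
    qed
    have "(LINT x:{0..}|stieltjes_measure \<alpha>. f n x) = (LINT x:{0..}|stieltjes_measure \<beta>. f n x)" if "n > 0" for n
    proof (rule eq[unfolded distribution_eq_def, rule_format])
      show "continuous_on {0..} (f n)" unfolding f_def by (intro continuous_intros)
      have "{x \<in> {0..}. f n x \<noteq> 0} \<subseteq> {0..\<bar>b\<bar> + 1}"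
      proof safe
        fix x assume "0 \<le> x" "f n x \<noteq> 0"
        then have "real n * (x - b) < 1" by (auto simp: f_def max_def min_def split: if_splits)
        then have "x - b < 1" using that
          by (smt (verit) mult_le_cancel_right1 of_nat_1 of_nat_le_iff Suc_leI One_nat_def)
        with \<open>0 \<le> x\<close> show "x \<in> {0..\<bar>b\<bar> + 1}" by auto
      qed
      then have "bounded {x \<in> {0..}. f n x \<noteq> 0}" using bounded_subset bounded_closed_interval by blast
      then show "compact (closure {x \<in> {0..}. f n x \<noteq> 0})" by simp
    qed
    then have ev: "eventually (\<lambda>n. (LINT x:{0..}|stieltjes_measure \<alpha>. f n x) = (LINT x:{0..}|stieltjes_measure \<beta>. f n x)) sequentially"
      by (auto simp: eventually_sequentially intro!: exI[of _ 1])
    show "cdf (stieltjes_measure \<alpha>) b = cdf (stieltjes_measure \<beta>) b"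
      using conv[OF fin(1) pos(1)] conv[OF fin(2) pos(2)] tendsto_cong[OF ev] LIMSEQ_unique by blast
  qed
qed

lemma ennreal_powi:
  assumes "x > 0" shows "ennreal x powi n = ennreal (x powi n)"
  using assms by (simp add: power_int_def ennreal_power inverse_ennreal)

lemma ext_moment_eq_nn_integral:
  assumes "AE x in stieltjes_measure F. 0 < x"
  shows "ext_moment F n = (\<integral>\<^sup>+x. ennreal (x powi n) \<partial>stieltjes_measure F)"
  unfolding ext_moment_def
proof (rule nn_integral_cong_AE)
  show "AE x in stieltjes_measure F. ennreal x powi n * indicator {0..} x = ennreal (x powi n)"
    using assms by eventually_elim (simp add: ennreal_powi)
qed

lemma powi_measurable [measurable]: "(\<lambda>x::real. x powi n) \<in> borel_measurable borel"
  unfolding power_int_def by (cases "n \<ge> 0") auto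

section \<open>Laurent polynomials and moments\<close>

text \<open>
  The exponent \<open>Suc N\<close> makes every member vanish at the origin, because \<open>x / 0 = 0\<close>; with exponent
  \<open>N\<close> the set would not be closed under addition at this point.
\<close>

definition laurent :: "(real \<Rightarrow> real) set" where
  "laurent = {\<lambda>u. poly p u / u ^ Suc N | p N. True}"

lemma laurent_linear_combination:
  assumes "r \<in> laurent" "s \<in> laurent"
  shows "(\<lambda>x. a * r x + b * s x) \<in> laurent"
proof -
  obtain p N q K where rs: "r = (\<lambda>u. poly p u / u ^ Suc N)" "s = (\<lambda>u. poly q u / u ^ Suc K)"
    using assms by (auto simp: laurent_def)
  let ?P = "smult a (monom 1 (Suc K) * p) + smult b (monom 1 (Suc N) * q)"
  have "(\<lambda>x. a * r x + b * s x) = (\<lambda>u. poly ?P u / u ^ Suc (N + Suc K))"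
  proof
    fix x :: real
    show "a * r x + b * s x = poly ?P x / x ^ Suc (N + Suc K)"
      by (cases "x = 0") (simp_all add: rs poly_monom field_simps power_add)
  qed
  then show ?thesis unfolding laurent_def by blast
qed

lemma laurent_square:
  assumes "r \<in> laurent" shows "(\<lambda>x. (r x)\<^sup>2) \<in> laurent"
proof -
  obtain p N where r: "r = (\<lambda>u. poly p u / u ^ Suc N)" using assms by (auto simp: laurent_def)
  have "(\<lambda>x. (r x)\<^sup>2) = (\<lambda>u. poly (p * p) u / u ^ Suc (N + Suc N))"
    by (auto simp: r power2_eq_square power_add)
  then show ?thesis unfolding laurent_def by blast
qed

locale finite_laurent_moments = finite_measure M for M :: "real measure" +
  assumes sets_M: "sets M = sets borel"
    and pos: "AE x in M. 0 < x"
    and powi: "\<And>n. integrable M (\<lambda>x. x powi n)"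
begin

lemma integrable_laurent: "integrable M (\<lambda>u. poly p u / u ^ N)"
proof (rule integrable_cong_AE_imp)
  show "integrable M (\<lambda>u. \<Sum>i\<le>degree p. coeff p i * u powi (int i - int N))"
    by (intro Bochner_Integration.integrable_sum integrable_mult_right powi)
  show "AE u in M. (\<Sum>i\<le>degree p. coeff p i * u powi (int i - int N)) = poly p u / u ^ N"
    using pos by eventually_elim (simp add: poly_altdef sum_divide_distrib power_int_diff)
  have "(\<lambda>u::real. poly p u) \<in> borel_measurable borel"
    by (intro borel_measurable_continuous_onI continuous_intros)
  then show "(\<lambda>u. poly p u / u ^ N) \<in> borel_measurable M"
    unfolding measurable_cong_sets[OF sets_M refl] by measurable
qed

lemma integrable_resolvent: "integrable M (\<lambda>u. 1 / (1 + u))"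
proof (rule integrable_const_bound[of _ 1])
  show "AE u in M. norm (1 / (1 + u)) \<le> 1" using pos by eventually_elim auto
  show "(\<lambda>u. 1 / (1 + u)) \<in> borel_measurable M"
    unfolding measurable_cong_sets[OF sets_M refl] by measurable
qed

lemma exists_laurent_annihilator:
  assumes "c > 0"
    "\<And>p N. integrable M (\<lambda>u. 1 / (1 + u) - poly p u / u ^ N) \<Longrightarrow>
      c \<le> (LINT u|M. min 1 \<bar>1 / (1 + u) - poly p u / u ^ N\<bar>) * (LINT u|M. max 1 \<bar>1 / (1 + u) - poly p u / u ^ N\<bar>)"
  obtains \<phi> where "\<phi> \<in> borel_measurable M" "\<And>x. \<bar>\<phi> x\<bar> \<le> 1"
    "\<And>n. (LINT x|M. \<phi> x * x powi n) = 0" "\<not> (AE x in M. \<phi> x = 0)"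
proof -
  have V0: "(\<lambda>_. 0) \<in> laurent"
  proof -
    have "(\<lambda>_. 0) = (\<lambda>u :: real. poly 0 u / u ^ Suc 0)" by simp
    then show ?thesis unfolding laurent_def by blast
  qed
  have int: "integrable M r" if "r \<in> laurent" for r
    using that integrable_laurent by (auto simp: laurent_def simp del: power_Suc)
  have int2: "integrable M (\<lambda>x. (r x)\<^sup>2)" if "r \<in> laurent" for r
    using int laurent_square[OF that] by blast
  have sep: "c \<le> (LINT x|M. min 1 \<bar>1 / (1 + x) - r x\<bar>) * (LINT x|M. max 1 \<bar>1 / (1 + x) - r x\<bar>)"
    if r: "r \<in> laurent" for r
  proof -
    obtain p N where r: "r = (\<lambda>u. poly p u / u ^ Suc N)" using r by (auto simp: laurent_def)
    show ?thesis unfolding r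
      by (intro assms(2) Bochner_Integration.integrable_diff integrable_resolvent integrable_laurent)
  qed
  obtain \<phi> where \<phi>: "\<phi> \<in> borel_measurable M" "\<And>x. \<bar>\<phi> x\<bar> \<le> 1"
    "\<And>r. r \<in> laurent \<Longrightarrow> (LINT x|M. \<phi> x * r x) = 0" "\<not> (AE x in M. \<phi> x = 0)"
    using exists_bounded_annihilator[OF integrable_resolvent V0 laurent_linear_combination int int2 assms(1) sep]
    by blast
  have "(LINT x|M. \<phi> x * x powi n) = 0" for n
  proof -
    \<comment> \<open>As \<open>nat\<close> truncates, \<open>u powi n = u ^ nat n / u ^ nat (- n)\<close> for either sign of \<open>n\<close>; the extra factor \<open>u\<close> cancels.\<close>
    let ?r = "\<lambda>u::real. poly (monom 1 (Suc (nat n))) u / u ^ Suc (nat (- n))"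
    have r: "?r \<in> laurent" unfolding laurent_def by blast
    note [measurable] = \<phi>(1) borel_measurable_integrable[OF powi[of n]] borel_measurable_integrable[OF int[OF r]]
    have eq: "AE x in M. \<phi> x * x powi n = \<phi> x * ?r x"
      using pos by eventually_elim (simp add: poly_monom power_int_def field_simps)
    have "(LINT x|M. \<phi> x * x powi n) = (LINT x|M. \<phi> x * ?r x)"
      by (rule integral_cong_AE; (rule eq | measurable))
    with \<phi>(3)[OF r] show ?thesis by simp
  qed
  with \<phi> show thesis by (intro that[of \<phi>]) auto
qed

lemma powi_moment_perturbed:
  assumes [measurable]: "\<phi> \<in> borel_measurable M" and \<phi>: "\<And>x. \<bar>\<phi> x\<bar> \<le> 1"
    and orth: "\<And>n. (LINT x|M. \<phi> x * x powi n) = 0"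
  shows "(\<integral>\<^sup>+x. ennreal (x powi n) \<partial>density M (\<lambda>x. ennreal (1 + \<phi> x / 2))) = (\<integral>\<^sup>+x. ennreal (x powi n) \<partial>M)"
proof -
  have [measurable]: "(\<lambda>x. x powi k) \<in> borel_measurable M" for k
    unfolding measurable_cong_sets[OF sets_M refl] by measurable
  have \<phi>': "1 + \<phi> x / 2 \<ge> 0" for x using \<phi>[of x] by (simp add: abs_le_iff)
  have int: "integrable M (\<lambda>x. \<phi> x * x powi n)"
    by (rule Bochner_Integration.integrable_bound[OF powi[of n]])
      (auto simp: abs_mult \<phi> intro!: mult_left_le_one_le)
  then have int2: "integrable M (\<lambda>x. x powi n + 1 / 2 * (\<phi> x * x powi n))"
    by (intro Bochner_Integration.integrable_add powi integrable_mult_right)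
  have nn: "AE x in M. 0 \<le> x powi n" using pos by eventually_elim simp
  have "(\<integral>\<^sup>+x. ennreal (x powi n) \<partial>density M (\<lambda>x. ennreal (1 + \<phi> x / 2))) =
      (\<integral>\<^sup>+x. ennreal (1 + \<phi> x / 2) * ennreal (x powi n) \<partial>M)"
    by (rule nn_integral_density) measurable
  also have "\<dots> = (\<integral>\<^sup>+x. ennreal (x powi n + 1 / 2 * (\<phi> x * x powi n)) \<partial>M)"
  proof (rule nn_integral_cong)
    fix x
    have "ennreal (1 + \<phi> x / 2) * ennreal (x powi n) = ennreal ((1 + \<phi> x / 2) * x powi n)"
      by (rule ennreal_mult'[OF \<phi>', symmetric])
    also have "(1 + \<phi> x / 2) * x powi n = x powi n + 1 / 2 * (\<phi> x * x powi n)"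
      by (simp add: algebra_simps)
    finally show "ennreal (1 + \<phi> x / 2) * ennreal (x powi n) = ennreal (x powi n + 1 / 2 * (\<phi> x * x powi n))" .
  qed
  also have "\<dots> = ennreal (LINT x|M. x powi n + 1 / 2 * (\<phi> x * x powi n))"
  proof (rule nn_integral_eq_integral[OF int2])
    show "AE x in M. 0 \<le> x powi n + 1 / 2 * (\<phi> x * x powi n)"
      using nn
    proof eventually_elim
      case (elim x)
      have "x powi n + 1 / 2 * (\<phi> x * x powi n) = (1 + \<phi> x / 2) * x powi n" by (simp add: algebra_simps)
      then show ?case using elim \<phi>'[of x] by simp
    qed
  qed
  also have "(LINT x|M. x powi n + 1 / 2 * (\<phi> x * x powi n)) = (LINT x|M. x powi n)"
    using int powi[of n] orth[of n] by simp
  also have "ennreal \<dots> = (\<integral>\<^sup>+x. ennreal (x powi n) \<partial>M)"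
    using nn powi[of n] by (intro nn_integral_eq_integral[symmetric]) auto
  finally show ?thesis .
qed

end

section \<open>The density of the absolutely continuous part\<close>

text \<open>
  The squares that lie in a given null set come from a null set: this is
  \<open>half_cauchy_square_density_bound\<close> for Lebesgue measure and the indicator of the given set.
\<close>

lemma AE_half_cauchy_square:
  assumes "AE u in lborel. P u"
  shows "AE t in half_cauchy. P (t\<^sup>2)"
proof -
  from assms obtain B where B: "B \<in> null_sets lborel" "{u. \<not> P u} \<subseteq> B"
    by (auto simp: eventually_ae_filter)
  let ?F = "\<lambda>t::real. indicator B (t\<^sup>2) * (1 * (pi * t * (1 + t\<^sup>2))) :: real"
  have [measurable]: "B \<in> sets borel" using B(1) by auto
  have int: "integrable lborel (indicator B :: real \<Rightarrow> real)" and zero: "integral\<^sup>L lborel (indicator B :: real \<Rightarrow> real) = 0"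
    using B(1) by (auto simp: null_sets_def measure_def)
  have "density lborel (\<lambda>x. ennreal 1) \<le> (lborel :: real measure)"
    by (simp add: density_1)
  note F = half_cauchy_square_density_bound[OF _ this, of "indicator B :: real \<Rightarrow> real", simplified]
  have F_int: "integrable half_cauchy ?F" and F_le: "half_cauchy.expectation ?F \<le> 0"
    using F int zero by auto
  have nn: "AE t in half_cauchy. 0 \<le> ?F t"
    using AE_half_cauchy_pos by eventually_elim (auto simp: indicator_def)
  have "half_cauchy.expectation ?F = 0"
    using F_le integral_nonneg_AE[OF nn] by simp
  then have "AE t in half_cauchy. ?F t = 0"
    using integral_nonneg_eq_0_iff_AE[OF F_int nn] by simp
  with AE_half_cauchy_pos show ?thesis
  proof eventually_elim
    case (elim t)
    have "1 + t\<^sup>2 > 0" by (simp add: add_pos_nonneg)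
    with elim have "t\<^sup>2 \<notin> B" by (auto simp: indicator_def)
    with B(2) show "P (t\<^sup>2)" by auto
  qed
qed

lemma ac_derivative_density_le:
  assumes F: "distribution_function {0..} F"
  shows "density lborel (ac_derivative F) \<le> stieltjes_measure F"
    and "AE u in lborel. ac_derivative F u \<noteq> \<infinity>"
proof -
  let ?M = "stieltjes_measure F" and ?A = "ac_part (stieltjes_measure F)"
  interpret finite_measure ?M by (rule finite_measure_stieltjes_measure[OF F])
  from is_ac_part_ac_part[OF F] obtain S where A: "sets ?A = sets borel" "absolutely_continuous lborel ?A"
    and S: "\<And>B. B \<in> sets borel \<Longrightarrow> emeasure ?M B = emeasure ?A B + emeasure S B"
    by (auto simp: is_ac_part_def)
  have sA: "space ?A = UNIV" using sets_eq_imp_space_eq[OF A(1)] by simp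
  have dens: "density lborel (ac_derivative F) = ?A"
    unfolding ac_derivative_def by (rule sigma_finite_measure.density_RN_deriv[OF sigma_finite_lborel]) (use A in auto)
  have "emeasure ?A B \<le> emeasure ?M B" for B
    using S[of B] A(1) by (cases "B \<in> sets borel") (auto simp: emeasure_notin_sets)
  then show "density lborel (ac_derivative F) \<le> ?M"
    unfolding dens by (simp add: le_measure_iff A(1) sA le_fun_def)
  have "emeasure ?A UNIV < \<infinity>"
    using S[of UNIV] emeasure_finite[of UNIV] by (simp add: less_top)
  then have "finite_measure ?A" by (intro finite_measureI) (auto simp: sA less_top)
  then have "sigma_finite_measure ?A" by (simp add: finite_measure.axioms(1))
  from sigma_finite_measure.RN_deriv_finite[OF sigma_finite_lborel this A(2)] A(1)
  show "AE u in lborel. ac_derivative F u \<noteq> \<infinity>" by (simp add: ac_derivative_def)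
qed

text \<open>
  The positive part of the logarithmic integral is always finite:
  \<open>ln w(t\<^sup>2) \<le> \<pi> t (1+t\<^sup>2) w(t\<^sup>2) + \<bar>ln t\<^sup>2\<bar>\<close>, and both terms have a finite half-Cauchy mean. Hence
  a value above \<open>-\<infinity>\<close> forces the negative part to be finite as well.
\<close>

lemma log_integral_finite:
  assumes F: "distribution_function {0..} F" and log: "log_integral F > -\<infinity>"
  obtains w where "w \<in> borel_measurable borel" "\<And>x. w x \<ge> 0"
    "density lborel (\<lambda>x. ennreal (w x)) \<le> stieltjes_measure F"
    "AE t in half_cauchy. w (t\<^sup>2) > 0" "integrable half_cauchy (\<lambda>t. ln (w (t\<^sup>2)))"
proof -
  let ?M = "stieltjes_measure F"
  interpret M: finite_measure ?M by (rule finite_measure_stieltjes_measure[OF F])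
  define v where "v = ac_derivative F"
  define w where "w x = enn2real (v x)" for x
  have [measurable]: "v \<in> borel_measurable borel"
    using borel_measurable_RN_deriv[of lborel] by (simp add: v_def ac_derivative_def)
  have wm [measurable]: "w \<in> borel_measurable borel" unfolding w_def by measurable
  have w0: "w x \<ge> 0" for x by (simp add: w_def)
  have fin: "AE u in lborel. v u \<noteq> \<infinity>"
    unfolding v_def by (rule ac_derivative_density_le(2)[OF F])
  have "density lborel (\<lambda>x. ennreal (w x)) = density lborel v"
    by (rule density_cong) (use fin in \<open>auto simp: w_def less_top\<close>)
  then have dens: "density lborel (\<lambda>x. ennreal (w x)) \<le> ?M"
    using ac_derivative_density_le(1)[OF F] by (simp add: v_def)
  have fin2: "AE t in lborel. t > 0 \<longrightarrow> v (t\<^sup>2) \<noteq> \<infinity>"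
    using AE_half_cauchy_square[OF fin] by (subst (asm) AE_half_cauchy_iff) auto
  define f where "f u = ext_ln (v (u\<^sup>2)) / ereal (1 + u\<^sup>2)" for u
  have [measurable]: "f \<in> borel_measurable borel"
    unfolding f_def ext_ln_def by measurable
  let ?R = "restrict_space lborel {0 :: real..}"
  have R: "(\<integral>\<^sup>+u. g u \<partial>?R) = (\<integral>\<^sup>+u. g u * indicator {0<..} u \<partial>lborel)" for g :: "real \<Rightarrow> ennreal"
  proof -
    have "(\<integral>\<^sup>+u. g u \<partial>?R) = (\<integral>\<^sup>+u. g u * indicator {0..} u \<partial>lborel)"
      by (rule nn_integral_restrict_space) simp
    also have "\<dots> = (\<integral>\<^sup>+u. g u * indicator {0<..} u \<partial>lborel)"
    proof (rule nn_integral_cong_AE)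
      show "AE u in lborel. g u * indicator {0..} u = g u * indicator {0<..} u"
        using AE_lborel_singleton[of 0] by eventually_elim (auto simp: indicator_def)
    qed
    finally show ?thesis .
  qed
  have f_pos: "f u = ereal (ln (w (u\<^sup>2)) / (1 + u\<^sup>2))" if "v (u\<^sup>2) \<noteq> \<infinity>" "v (u\<^sup>2) \<noteq> 0" for u
  proof -
    have "1 + u\<^sup>2 > 0" by (simp add: add_pos_nonneg)
    then show ?thesis using that by (simp add: f_def ext_ln_def w_def)
  qed
  have f_zero: "f u = -\<infinity>" if "v (u\<^sup>2) = 0" for u
  proof -
    have "1 + u\<^sup>2 > 0" by (simp add: add_pos_nonneg)
    then show ?thesis using that by (simp add: f_def ext_ln_def)
  qed
  \<comment> \<open>The term \<open>- 0\<close> exhibits the logarithm as the case \<open>s = 0\<close> of \<open>half_cauchy_ln_square_minus_nonneg\<close>.\<close>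
  define G where "G t = w (t\<^sup>2) * (pi * t * (1 + t\<^sup>2)) + \<bar>ln \<bar>t\<^sup>2 - 0\<bar>\<bar>" for t
  have G_int: "integrable half_cauchy G"
  proof -
    have "integrable half_cauchy (\<lambda>t. 1 * (w (t\<^sup>2) * (pi * t * (1 + t\<^sup>2))))"
      by (rule half_cauchy_square_density_bound(1)[OF _ dens wm w0, of "\<lambda>_. 1"]) auto
    then show ?thesis
      unfolding G_def
      by (intro Bochner_Integration.integrable_add integrable_abs half_cauchy_ln_square_minus_nonneg(1)) auto
  qed
  then have [measurable]: "G \<in> borel_measurable borel" by (auto dest: borel_measurable_integrable)
  have ln_le: "ln (w (t\<^sup>2)) \<le> G t" if "t > 0" "w (t\<^sup>2) > 0" for t
  proof -
    have pos: "1 + t\<^sup>2 > 0" "w (t\<^sup>2) * (pi * t * (1 + t\<^sup>2)) > 0"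
      using that by (auto simp: add_pos_nonneg)
    have "ln (w (t\<^sup>2)) + (ln pi + ln t + ln (1 + t\<^sup>2)) = ln (w (t\<^sup>2) * (pi * t * (1 + t\<^sup>2)))"
      using that pos(1) by (simp add: ln_mult_pos)
    also have "\<dots> \<le> w (t\<^sup>2) * (pi * t * (1 + t\<^sup>2))"
      using pos(2) ln_bound by blast
    finally have "ln (w (t\<^sup>2)) \<le> w (t\<^sup>2) * (pi * t * (1 + t\<^sup>2)) - ln pi - ln t - ln (1 + t\<^sup>2)" by simp
    moreover have "ln pi \<ge> 0" using pi_gt3 by (intro ln_ge_zero) simp
    moreover have "ln (1 + t\<^sup>2) \<ge> 0" by (intro ln_ge_zero) simp
    moreover have "- ln t \<le> \<bar>ln \<bar>t\<^sup>2 - 0\<bar>\<bar>" using that by (simp add: ln_realpow)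
    ultimately show ?thesis unfolding G_def by linarith
  qed
  have G0: "G t \<ge> 0" if "t > 0" for t
    using that w0 by (auto simp: G_def intro!: add_nonneg_nonneg mult_nonneg_nonneg)
  have "(\<integral>\<^sup>+u. e2ennreal (f u) \<partial>?R) \<le> (\<integral>\<^sup>+u. ennreal (indicator {0<..} u *\<^sub>R (G u / (1 + u\<^sup>2))) \<partial>lborel)"
    unfolding R
  proof (rule nn_integral_mono_AE)
    show "AE u in lborel. e2ennreal (f u) * indicator {0<..} u \<le> ennreal (indicator {0<..} u *\<^sub>R (G u / (1 + u\<^sup>2)))"
      using fin2
    proof eventually_elim
      case (elim u)
      show ?case
      proof (cases "u > 0 \<and> v (u\<^sup>2) \<noteq> 0")
        case True
        then have "w (u\<^sup>2) > 0" using elim by (auto simp: w_def enn2real_positive_iff less_top zero_less_iff_neq_zero)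
        then have "ln (w (u\<^sup>2)) / (1 + u\<^sup>2) \<le> G u / (1 + u\<^sup>2)"
          using ln_le True by (intro divide_right_mono) auto
        then show ?thesis using True elim f_pos[of u] by (auto intro: ennreal_leI)
      qed (auto simp: f_zero e2ennreal_neg)
    qed
  qed
  also have "\<dots> < \<infinity>"
  proof -
    have "integrable lborel (\<lambda>u. indicator {0<..} u *\<^sub>R (G u / (1 + u\<^sup>2)))"
      using G_int by (simp add: integrable_half_cauchy_iff set_integrable_def)
    then have "(\<integral>\<^sup>+u. ennreal (norm (indicator {0<..} u *\<^sub>R (G u / (1 + u\<^sup>2)))) \<partial>lborel) < \<infinity>"
      by (simp only: integrable_iff_bounded)
    moreover have "norm (indicator {0<..} u *\<^sub>R (G u / (1 + u\<^sup>2))) = indicator {0<..} u *\<^sub>R (G u / (1 + u\<^sup>2))" for u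
      using G0[of u] by (auto simp: indicator_def)
    ultimately show ?thesis by (simp only:)
  qed
  finally have fpos: "(\<integral>\<^sup>+u. e2ennreal (f u) \<partial>?R) < \<infinity>" .
  have fneg: "(\<integral>\<^sup>+u. e2ennreal (- f u) \<partial>?R) \<noteq> \<infinity>"
  proof
    assume "(\<integral>\<^sup>+u. e2ennreal (- f u) \<partial>?R) = \<infinity>"
    moreover obtain p where "(\<integral>\<^sup>+u. e2ennreal (f u) \<partial>?R) = ennreal p" "p \<ge> 0"
      using fpos by (cases "\<integral>\<^sup>+u. e2ennreal (f u) \<partial>?R" rule: ennreal_cases) auto
    ultimately have "log_integral F = -\<infinity>"
      unfolding log_integral_def ext_integral_def f_def[symmetric] v_def[symmetric] by (simp add: enn2ereal_ennreal)
    with log show False by simp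
  qed
  have "AE u in lborel. e2ennreal (- f u) * indicator {0<..} u \<noteq> \<infinity>"
    by (rule nn_integral_PInf_AE) (use fneg in \<open>auto simp: R\<close>)
  then have v0: "AE t in lborel. t > 0 \<longrightarrow> v (t\<^sup>2) \<noteq> 0"
    by eventually_elim (auto simp: f_zero)
  have w_pos: "AE t in lborel. t > 0 \<longrightarrow> w (t\<^sup>2) > 0"
    using v0 fin2 by eventually_elim (auto simp: w_def enn2real_positive_iff less_top zero_less_iff_neq_zero)
  show thesis
  proof (rule that[OF wm w0 dens])
    show "AE t in half_cauchy. w (t\<^sup>2) > 0"
      using w_pos by (subst AE_half_cauchy_iff) auto
    have "(\<integral>\<^sup>+u. ennreal (norm (indicator {0<..} u *\<^sub>R (ln (w (u\<^sup>2)) / (1 + u\<^sup>2)))) \<partial>lborel)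
        \<le> (\<integral>\<^sup>+u. e2ennreal (f u) * indicator {0<..} u + e2ennreal (- f u) * indicator {0<..} u \<partial>lborel)"
    proof (rule nn_integral_mono_AE)
      show "AE u in lborel. ennreal (norm (indicator {0<..} u *\<^sub>R (ln (w (u\<^sup>2)) / (1 + u\<^sup>2))))
          \<le> e2ennreal (f u) * indicator {0<..} u + e2ennreal (- f u) * indicator {0<..} u"
        using v0 fin2
      proof eventually_elim
        case (elim u)
        have "ennreal (norm y) \<le> ennreal y + ennreal (- y)" for y :: real
          by (cases "y \<ge> 0") (auto simp: ennreal_neg)
        from this[of "ln (w (u\<^sup>2)) / (1 + u\<^sup>2)"] show ?case
          using elim f_pos[of u] by (auto simp: indicator_def simp del: real_norm_def)
      qed
    qed
    also have "\<dots> = (\<integral>\<^sup>+u. e2ennreal (f u) \<partial>?R) + (\<integral>\<^sup>+u. e2ennreal (- f u) \<partial>?R)"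
      unfolding R by (rule nn_integral_add) auto
    also have "\<dots> < \<infinity>" using fpos fneg by (simp add: less_top)
    finally show "integrable half_cauchy (\<lambda>t. ln (w (t\<^sup>2)))"
      by (subst integrable_half_cauchy_iff) (auto simp: set_integrable_def integrable_iff_bounded)
  qed
qed

text \<open>
  Consequently every point of the half-line is a point of increase of the distribution function of
  \<open>M\<close>, and of any measure bounded below by a positive multiple of \<open>M\<close>.
\<close>

lemma measure_Ioc_pos:
  fixes w :: "real \<Rightarrow> real"
  assumes M: "finite_measure M" "sets M = sets borel" "density lborel (\<lambda>x. ennreal (w x)) \<le> M"
    and w: "w \<in> borel_measurable borel" "\<And>x. w x \<ge> 0"
    and w_pos: "AE t in half_cauchy. w (t\<^sup>2) > 0"
    and ab: "0 \<le> a" "a < b"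
  shows "measure M {a<..b} > 0"
proof (rule ccontr)
  interpret finite_measure M by (rule M(1))
  assume "\<not> measure M {a<..b} > 0"
  then have 0: "measure M {a<..b} = 0" by (simp add: zero_less_measure_iff)
  have space: "space M = UNIV" using sets_eq_imp_space_eq[OF M(2)] by simp
  have meas: "{a<..b} \<in> sets M" by (simp add: M(2))
  let ?F = "\<lambda>t::real. indicator {a<..b} (t\<^sup>2) * (w (t\<^sup>2) * (pi * t * (1 + t\<^sup>2))) :: real"
  have "integrable M (indicator {a<..b} :: real \<Rightarrow> real)"
    using meas by (rule integrable_real_indicator) (simp add: emeasure_eq_measure)
  note F = half_cauchy_square_density_bound[OF M(2,3) w this]
  have nn: "AE t in half_cauchy. 0 \<le> ?F t"
    using AE_half_cauchy_pos by eventually_elim (use w(2) in \<open>auto simp: indicator_def\<close>)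
  have "half_cauchy.expectation ?F \<le> 0"
    using F(2) 0 space by simp
  then have "half_cauchy.expectation ?F = 0"
    using integral_nonneg_AE[OF nn] by simp
  then have "AE t in half_cauchy. ?F t = 0"
    using integral_nonneg_eq_0_iff_AE[OF F(1) nn] by simp
  with AE_half_cauchy_pos w_pos have "AE t in half_cauchy. t\<^sup>2 \<notin> {a<..b}"
  proof eventually_elim
    case (elim t)
    have "1 + t\<^sup>2 > 0" by (simp add: add_pos_nonneg)
    with elim show ?case by (auto simp: indicator_def)
  qed
  then have "AE t in lborel. t > 0 \<longrightarrow> t\<^sup>2 \<notin> {a<..b}"
    by (subst (asm) AE_half_cauchy_iff) auto
  then have "AE t in lborel. t \<notin> {sqrt a<..<sqrt b}"
  proof eventually_elim
    case (elim t)
    show ?case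
    proof
      assume t: "t \<in> {sqrt a<..<sqrt b}"
      then have "t > 0" using ab real_sqrt_ge_zero[of a] le_less_trans[of 0 "sqrt a" t] by auto
      moreover have "(sqrt a)\<^sup>2 < t\<^sup>2" "t\<^sup>2 < (sqrt b)\<^sup>2"
        using t ab \<open>t > 0\<close> by (intro power_strict_mono; simp)+
      then have "a < t\<^sup>2" "t\<^sup>2 < b" using ab by auto
      ultimately show False using elim by auto
    qed
  qed
  then have "emeasure lborel {sqrt a<..<sqrt b} = 0"
    by (subst AE_iff_measurable[symmetric, where P = "\<lambda>t. t \<notin> {sqrt a<..<sqrt b}"]) auto
  then show False using ab by (simp add: real_sqrt_less_iff)
qed

section \<open>Indeterminacy\<close>

theorem theorem4p2:
  fixes \<sigma> :: "real \<Rightarrow> real" and \<mu> :: "int \<Rightarrow> real"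
  assumes "distribution_function {0..} \<sigma>"
    and "finite_moments \<sigma>"
    and "\<And>n. \<mu> n = moment \<sigma> n"
    and "log_integral \<sigma> > -\<infinity>"
  shows "indeterminate \<mu>"
proof
  assume det: "determinate \<mu>"
  define M where "M = stieltjes_measure \<sigma>"
  have M_fin: "finite_measure M" unfolding M_def by (rule finite_measure_stieltjes_measure[OF assms(1)])
  interpret finite_measure M by (rule M_fin)
  have sM: "sets M = sets borel" and space: "space M = UNIV" by (simp_all add: M_def)
  have pos: "AE x in M. 0 < x" unfolding M_def by (rule AE_stieltjes_measure_pos[OF assms(1,2)])
  have powi: "integrable M (\<lambda>x. x powi n)" for n
  proof (rule integrableI_nonneg)
    show "(\<lambda>x. x powi n) \<in> borel_measurable M" unfolding measurable_cong_sets[OF sM refl] by measurable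
    show "AE x in M. 0 \<le> x powi n" using pos by eventually_elim simp
    show "(\<integral>\<^sup>+x. ennreal (x powi n) \<partial>M) < \<infinity>"
      using assms(2) unfolding finite_moments_def M_def ext_moment_eq_nn_integral[OF pos[unfolded M_def], symmetric]
      by blast
  qed
  interpret L: finite_laurent_moments M by standard (use sM pos powi in auto)
  obtain w where w: "w \<in> borel_measurable borel" "\<And>x. w x \<ge> 0"
    "density lborel (\<lambda>x. ennreal (w x)) \<le> M"
    "AE t in half_cauchy. w (t\<^sup>2) > 0" "integrable half_cauchy (\<lambda>t. ln (w (t\<^sup>2)))"
    using log_integral_finite[OF assms(1,4)] unfolding M_def by metis
  obtain c where c: "c > 0" "\<And>p N. integrable M (\<lambda>u. 1 / (1 + u) - poly p u / u ^ N) \<Longrightarrow>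
      c \<le> (LINT u|M. min 1 \<bar>1 / (1 + u) - poly p u / u ^ N\<bar>) * (LINT u|M. max 1 \<bar>1 / (1 + u) - poly p u / u ^ N\<bar>)"
    by (rule log_integrable_density_separates[OF M_fin sM w(3,1,2,4,5)]) blast
  obtain \<phi> where \<phi> [measurable]: "\<phi> \<in> borel_measurable M" and \<phi>1: "\<And>x. \<bar>\<phi> x\<bar> \<le> 1"
    and orth: "\<And>n. (LINT x|M. \<phi> x * x powi n) = 0" and \<phi>0: "\<not> (AE x in M. \<phi> x = 0)"
    by (rule L.exists_laurent_annihilator[OF c]) blast+
  define N where "N = density M (\<lambda>x. ennreal (1 + \<phi> x / 2))"
  have N_meas: "(\<lambda>x. ennreal (1 + \<phi> x / 2)) \<in> borel_measurable M" by measurable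
  have sN: "sets N = sets borel" by (simp add: N_def sM)
  have N_pos: "AE x in N. 0 < x"
    unfolding N_def by (subst AE_density[OF N_meas]) (use pos in auto)
  have "(\<integral>\<^sup>+x. ennreal (x powi 0) \<partial>N) = (\<integral>\<^sup>+x. ennreal (x powi 0) \<partial>M)"
    unfolding N_def by (rule L.powi_moment_perturbed[OF \<phi> \<phi>1 orth])
  then have "emeasure N (space N) = emeasure M (space M)" by simp
  then have N_fin: "finite_measure N" by (intro finite_measureI) (simp add: emeasure_eq_measure)
  have N_fb: "finite_borel_measure N"
    using N_fin sN by (auto simp: finite_borel_measure_def finite_borel_measure_axioms_def)
  interpret N: finite_borel_measure N by (rule N_fb)
  define \<beta> where "\<beta> = cdf N"
  have \<beta>: "stieltjes_measure \<beta> = N"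
    unfolding \<beta>_def by (rule stieltjes_measure_cdf[OF N_fb N_pos])
  have \<beta>_less: "\<beta> a < \<beta> b" if ab: "0 \<le> a" "a < b" for a b
  proof -
    have "ennreal (1 / 2) * emeasure M {a<..b} = (\<integral>\<^sup>+x. ennreal (1 / 2) * indicator {a<..b} x \<partial>M)"
      by (rule nn_integral_cmult_indicator[symmetric]) (simp add: sM)
    also have "\<dots> \<le> (\<integral>\<^sup>+x. ennreal (1 + \<phi> x / 2) * indicator {a<..b} x \<partial>M)"
    proof (intro nn_integral_mono mult_right_mono ennreal_leI)
      show "1 / 2 \<le> 1 + \<phi> x / 2" for x using \<phi>1[of x] by (simp add: abs_le_iff)
    qed auto
    also have "\<dots> = emeasure N {a<..b}"
      unfolding N_def by (rule emeasure_density[symmetric]) (simp_all add: sM N_meas)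
    finally have "ennreal (1 / 2 * measure M {a<..b}) \<le> ennreal (measure N {a<..b})"
      unfolding emeasure_eq_measure N.emeasure_eq_measure by (subst ennreal_mult') auto
    then have "1 / 2 * measure M {a<..b} \<le> measure N {a<..b}"
      by (subst (asm) ennreal_le_iff) auto
    moreover have "measure M {a<..b} > 0"
      by (rule measure_Ioc_pos[OF M_fin sM w(3,1,2,4) ab])
    ultimately show ?thesis using N.cdf_diff_eq[OF ab(2)] by (simp add: \<beta>_def)
  qed
  have "distribution_function {0..} \<beta>"
    unfolding distribution_function_def
  proof (intro conjI)
    show "bounded (\<beta> ` {0..})"
      unfolding bounded_iff \<beta>_def cdf_def
      by (intro exI[of _ "measure N (space N)"]) (auto intro: N.bounded_measure)
    show "mono_on {0..} \<beta>"
      unfolding \<beta>_def by (intro mono_onI N.cdf_nondecreasing)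
    have "point_of_increase {0..} \<beta> x" if "x \<ge> 0" for x
      unfolding point_of_increase_def
    proof (intro conjI allI impI)
      fix \<epsilon> :: real assume "\<epsilon> > 0"
      then show "\<exists>y\<in>{0..} \<inter> ball x \<epsilon>. \<exists>z\<in>{0..} \<inter> ball x \<epsilon>. \<beta> y < \<beta> z"
        using that by (intro bexI[of _ x] bexI[of _ "x + \<epsilon> / 2"] \<beta>_less) (auto simp: dist_real_def)
    qed (use that in auto)
    then have "{0..} \<subseteq> {x. point_of_increase {0..} \<beta> x}" by auto
    then show "infinite {x. point_of_increase {0..} \<beta> x}"
      using infinite_Ici finite_subset by blast
  qed
  moreover have mom: "ext_moment \<beta> n = ext_moment \<sigma> n" for n
    using L.powi_moment_perturbed[OF \<phi> \<phi>1 orth, of n, folded N_def]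
      ext_moment_eq_nn_integral[of \<beta> n, unfolded \<beta>, OF N_pos]
      ext_moment_eq_nn_integral[of \<sigma> n, folded M_def, OF pos]
    by simp
  ultimately have "strong_stieltjes_solution \<mu> \<beta>"
    using assms(2,3) by (simp add: strong_stieltjes_solution_def finite_moments_def moment_def)
  moreover have "strong_stieltjes_solution \<mu> \<sigma>"
    using assms by (simp add: strong_stieltjes_solution_def)
  ultimately have "distribution_eq \<sigma> \<beta>" using det by (auto simp: determinate_def)
  then have "M = N"
    using distribution_eq_imp_stieltjes_measure_eq[of \<sigma> \<beta>, unfolded \<beta>, folded M_def] M_fin N_fin pos N_pos
    by blast
  then have "density M (\<lambda>_. 1) = density M (\<lambda>x. ennreal (1 + \<phi> x / 2))"
    by (simp add: N_def density_1)
  then have "AE x in M. 1 = ennreal (1 + \<phi> x / 2)"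
    by (intro density_unique) auto
  then have "AE x in M. \<phi> x = 0"
  proof eventually_elim
    case (elim x)
    have "1 + \<phi> x / 2 \<ge> 0" using \<phi>1[of x] by (simp add: abs_le_iff)
    with elim have "1 + \<phi> x / 2 = 1" by (metis ennreal_1 ennreal_inj zero_le_one)
    then show ?case by simp
  qed
  with \<phi>0 show False ..
qed

end
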